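(* Let $0<\delta\le1$. There exists a constant $C_\delta>0$ depending only on $\delta$ such that the following holds. Let $p$ be a prime, $k\in\mathbb Z\setminus\{0\}$, $q_0\ge 1$ an integer and $a_0\in\mathbb Z$ with $\gcd(a_0,q_0)=1$. Define $$T_k(p):=\sum_{n=1}^{\infty}\frac{e(ka_0n^2/q_0)\left(1-e(kn^2/p^2)\right)}{n^{1+\delta}},\qquad M_k:=\int_0^\infty\frac{1-e(ku^2)}{u^{1+\delta}}\,du,$$ and set $E_k(p)=p^{\delta}T_k(p)-G(ka_0;q_0)M_k$. Then for any $0<\alpha\le1$, $$|E_k(p)|\le C_\delta\,q_0\,|k|^{\frac{\alpha+\delta}{2}}\,p^{-\alpha}.$$
   Context: Here $e(x):=e^{2\pi i x}$, and for integers $t$ and $q\ge1$, $G(t;q):=\frac1q\sum_{n=1}^{q}e\left(\frac{tn^2}{q}\right)$ is the quadratic Gauss mean. *)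

theory Defs
  imports "HOL-Analysis.Analysis" "HOL-Computational_Algebra.Primes"
begin

definition e :: "real \<Rightarrow> complex" where
  "e x = exp (2 * of_real pi * \<i> * of_real x)"

definition gauss_mean :: "int \<Rightarrow> nat \<Rightarrow> complex" where
  "gauss_mean t q =
     1 / of_nat q * (\<Sum>n=1..q. e (real_of_int t * real n ^ 2 / real q))"

text \<open>
  For \<open>\<delta> > 0\<close> the series below converges absolutely, and for \<open>0 < \<delta> < 2\<close> the integral
  does too, so neither \<open>suminf\<close> nor the Lebesgue integral falls back to its default value
  for the parameters of interest. The series is indexed from 0, hence the \<open>Suc n\<close>.
\<close>

definition T_sum :: "real \<Rightarrow> int \<Rightarrow> nat \<Rightarrow> int \<Rightarrow> nat \<Rightarrow> complex" where
  "T_sum \<delta> a0 q0 k p =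
     (\<Sum>n. e (real_of_int k * real_of_int a0 * real (Suc n) ^ 2 / real q0)
            * (1 - e (real_of_int k * real (Suc n) ^ 2 / real p ^ 2))
            / of_real (real (Suc n) powr (1 + \<delta>)))"

definition M_int :: "real \<Rightarrow> int \<Rightarrow> complex" where
  "M_int \<delta> k =
     (LBINT u:{0<..}. (1 - e (real_of_int k * u ^ 2)) / of_real (u powr (1 + \<delta>)))"

definition E_err :: "real \<Rightarrow> int \<Rightarrow> nat \<Rightarrow> int \<Rightarrow> nat \<Rightarrow> complex" where
  "E_err \<delta> a0 q0 k p =
     of_real (real p powr \<delta>) * T_sum \<delta> a0 q0 k p - gauss_mean (k * a0) q0 * M_int \<delta> k"

end

(* By the scaling u -> u / sqrt k the problem concerns the kernel f(u) = (1 - e(u^2)) / u^(1 + delta)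
   and the step h = sqrt k / p: with c(n) = e(k a0 n^2 / q0) one has to bound
   h * sum_n c(n) f(n h) - G * int f by O(q0 h^alpha).  (Negative k follow by conjugation.)
   Splitting n into residue classes mod q0 turns this into an average of Riemann sum errors with
   step H = q0 h and an offset 0 < s <= H, and it suffices to show that each such error is O(H).
   If H > 1/2, both sum and integral are O(1).  If H <= 1/2, cut at U of size about H^(-1/2).
   Below U the trapezoidal rule applies, because f'' = O(u^(-1-delta) + u^(1-delta)).
   Above U the monotone part u^(-1-delta) is telescoped, the oscillating integral is treated by
   partial integration, and the oscillating sum of e(u^2) u^(-1-delta) over u = U + m H is bounded by
   the Kusmin-Landau argument between consecutive resonances, at which the phase increment
   2 H u + H^2 is close to an integer j; the resonances cost O(j^(-1-delta)) each. *)

theory Submission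
  imports Defs
begin

text \<open>Neither method reaches O(H) alone. Far out, f'' grows like u^(1 - delta), which spoils
  the trapezoidal rule; the trivial bound for the oscillating sum above U gives only O(U^(-delta)).
  A cut with U^2 H of size 1 suits both sides. Below U there are at most U / H cells whose growing
  error part is H^3 U^(1 - delta), in total at most H times U^2 H. Above U, the terms before the
  first resonance and the boundary term of the partial integration both cost about U^(-2 - delta),
  which is at most H once U^2 H >= 1. Near 0 the cell errors H^3 (k H)^(-1 - delta) add up to H^(2 -
  delta) zeta(1 + delta), and H^(2 - delta) <= H since delta <= 1 and H <= 1. The resonance j lies
  at u of size j / H and involves about 1 / H terms, each of size (j / H)^(-1 - delta), so that it
  contributes O(H^delta j^(-1 - delta)); summing over j produces the same zeta value.\<close>

section \<open>The exponential function\<close>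

lemma e_eq_cis: "e x = cis (2 * pi * x)"
  by (simp add: e_def cis_conv_exp mult_ac)

lemma norm_e [simp]: "norm (e x) = 1"
  by (simp add: e_eq_cis)

lemma e_add: "e (x + y) = e x * e y"
  by (simp add: e_eq_cis cis_mult distrib_left)

lemma e_int [simp]: "e (of_int n) = 1"
  using cis_multiple_2pi[of "of_int n"] by (simp add: e_eq_cis mult_ac)

lemma e_minus: "e (- x) = cnj (e x)"
  by (simp add: e_eq_cis cis_cnj)

lemma has_vector_derivative_e_sq:
  "((\<lambda>u. e (u\<^sup>2)) has_vector_derivative (4 * of_real pi * \<i> * of_real u * e (u\<^sup>2))) (at u within S)"
proof -
  have "((\<lambda>z. exp (2 * of_real pi * \<i> * z\<^sup>2)) has_field_derivative
          (4 * of_real pi * \<i> * of_real u * exp (2 * of_real pi * \<i> * (of_real u)\<^sup>2))) (at (of_real u))"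
    by (auto intro!: derivative_eq_intros)
  from has_vector_derivative_real_field[OF this, of S] show ?thesis
    by (simp add: e_def of_real_power)
qed

lemma norm_one_minus_e_le: "norm (1 - e x) \<le> 2 * pi * \<bar>x\<bar>"
proof -
  have "norm (1 - e x) = 2 * \<bar>sin (pi * x)\<bar>"
    using dist_exp_i_1[of "2 * pi * x"] by (simp add: e_def norm_minus_commute mult_ac)
  also have "\<dots> \<le> 2 * \<bar>pi * x\<bar>"
    using abs_sin_x_le_abs_x[of "pi * x"] by simp
  finally show ?thesis by (simp add: abs_mult)
qed

lemma norm_one_minus_e_le_2: "norm (1 - e x) \<le> 2"
  using norm_triangle_ineq4[of 1 "e x"] by simp

section \<open>The kernel and its derivatives\<close>

text \<open>At u = 0 this is 0 / 0 = 0, so the integrals over \<open>{0..}\<close> and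
  \<open>{0<..}\<close> have the same integrand up to the indicator of a point where the kernel
  vanishes.\<close>

definition kern :: "real \<Rightarrow> real \<Rightarrow> complex" where
  "kern \<delta> u = (1 - e (u\<^sup>2)) / of_real (u powr (1 + \<delta>))"

lemma kern_eq: "kern \<delta> u = (1 - e (u\<^sup>2)) * of_real (u powr (- 1 - \<delta>))"
  using powr_minus[of u "1 + \<delta>"] by (simp add: kern_def divide_inverse flip: of_real_inverse)

lemma kern_0 [simp]: "kern \<delta> 0 = 0"
  by (simp add: kern_def)

lemma powr_antimono_base:
  fixes x y a :: real
  assumes "0 < x" "x \<le> y" "a \<le> 0"
  shows "y powr a \<le> x powr a"
  using assms powr_mono2'[of a x y] by auto

text \<open>On u <= 1 the bound 2 pi u^2 for the numerator leaves u^(1 - delta) <= 1, beyond 1 the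
  numerator is at most 2; in both cases a factor 4 pays for the shift to 1 + u. The shifted power
  has no singularity and an elementary primitive, so one majorant serves the integral and the
  sums.\<close>

lemma norm_kern_le:
  assumes "0 < \<delta>" "\<delta> \<le> 1" "0 \<le> u"
  shows "norm (kern \<delta> u) \<le> 8 * pi * (1 + u) powr (- 1 - \<delta>)"
proof (cases "u \<le> 1")
  case True
  show ?thesis
  proof (cases "u = 0")
    case False
    hence u: "u > 0" using assms by simp
    have "norm (kern \<delta> u) \<le> 2 * pi * u\<^sup>2 * u powr (- 1 - \<delta>)"
      using norm_one_minus_e_le[of "u\<^sup>2"] u unfolding kern_eq norm_mult
      by (intro mult_mono) auto
    also have "\<dots> = 2 * pi * u powr (1 - \<delta>)"
      using u by (simp add: powr_add[symmetric] flip: powr_numeral)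
    also have "\<dots> \<le> 2 * pi * 1"
      using u True assms by (intro mult_left_mono powr_le1) auto
    also have "\<dots> \<le> 8 * pi * (2 powr (- 1 - \<delta>))"
    proof -
      have "2 powr (- 2) \<le> 2 powr (- 1 - \<delta>)" using assms by (intro powr_mono) auto
      thus ?thesis using pi_gt_zero by (simp add: powr_minus powr_numeral mult.commute)
    qed
    also have "\<dots> \<le> 8 * pi * (1 + u) powr (- 1 - \<delta>)"
      using True u assms by (intro mult_left_mono powr_antimono_base) auto
    finally show ?thesis .
  qed auto
next
  case False
  hence u: "u > 1" by simp
  have "norm (kern \<delta> u) \<le> 2 * u powr (- 1 - \<delta>)"
    using norm_one_minus_e_le_2[of "u\<^sup>2"] u unfolding kern_eq norm_mult
    by (intro mult_mono) auto
  also have "\<dots> \<le> 2 * ((1 + u) / 2) powr (- 1 - \<delta>)"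
    using u assms by (intro mult_left_mono powr_antimono_base) auto
  also have "\<dots> = 2 * 2 powr (1 + \<delta>) * (1 + u) powr (- 1 - \<delta>)"
    using u powr_minus[of 2 "1 + \<delta>"] by (simp add: powr_divide field_simps)
  also have "\<dots> \<le> 2 * 2 powr 2 * (1 + u) powr (- 1 - \<delta>)"
    using assms by (intro mult_left_mono mult_right_mono powr_mono) auto
  also have "\<dots> \<le> 8 * pi * (1 + u) powr (- 1 - \<delta>)"
    using pi_ge_two by (intro mult_right_mono) (auto simp: powr_numeral)
  finally show ?thesis .
qed

lemma norm_kern_le_const:
  assumes "0 < \<delta>" "\<delta> \<le> 1" "0 \<le> u"
  shows "norm (kern \<delta> u) \<le> 8 * pi"
proof -
  have "8 * pi * (1 + u) powr (- 1 - \<delta>) \<le> 8 * pi * 1 powr (- 1 - \<delta>)"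
    using assms by (intro mult_left_mono powr_antimono_base) auto
  also have "8 * pi * 1 powr (- 1 - \<delta>) = 8 * pi" by simp
  finally show ?thesis using norm_kern_le[OF assms] by (rule order_trans[rotated])
qed

lemma has_vector_derivative_of_real_powr:
  assumes "u > 0"
  shows "((\<lambda>u. of_real (u powr a)) has_vector_derivative (of_real (a * u powr (a - 1)) :: complex)) (at u within S)"
  by (rule has_vector_derivative_of_real, rule DERIV_subset[OF _ subset_UNIV])
    (use assms in \<open>auto intro!: derivative_eq_intros\<close>)

definition kern' :: "real \<Rightarrow> real \<Rightarrow> complex" where
  "kern' \<delta> u = - 4 * of_real pi * \<i> * e (u\<^sup>2) * of_real (u powr (- \<delta>))
     - of_real (1 + \<delta>) * (1 - e (u\<^sup>2)) * of_real (u powr (- 2 - \<delta>))"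

definition kern'' :: "real \<Rightarrow> real \<Rightarrow> complex" where
  "kern'' \<delta> u =
     16 * of_real (pi\<^sup>2) * e (u\<^sup>2) * of_real (u powr (1 - \<delta>))
     + 4 * of_real pi * \<i> * e (u\<^sup>2) * of_real ((1 + 2 * \<delta>) * u powr (- 1 - \<delta>))
     + of_real ((1 + \<delta>) * (2 + \<delta>)) * (1 - e (u\<^sup>2)) * of_real (u powr (- 3 - \<delta>))"

lemma kern_has_vector_derivative:
  assumes "u > 0"
  shows "(kern \<delta> has_vector_derivative kern' \<delta> u) (at u within S)"
proof -
  have p: "u powr (- \<delta>) = u * u powr (- 1 - \<delta>)"
    using assms powr_add[of u 1 "- 1 - \<delta>"] by simp
  have q: "- 1 - \<delta> - 1 = - 2 - \<delta>" by simp
  show ?thesis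
    unfolding kern_eq[abs_def] kern'_def
    by (rule derivative_eq_intros has_vector_derivative_mult has_vector_derivative_e_sq
          has_vector_derivative_of_real_powr assms refl)+
      (simp only: q, simp add: p algebra_simps)
qed

lemma kern'_has_vector_derivative:
  assumes "u > 0"
  shows "(kern' \<delta> has_vector_derivative kern'' \<delta> u) (at u within S)"
proof -
  have p: "u powr (1 - \<delta>) = u * u powr (- \<delta>)" "u powr (-1-\<delta>) = u * u powr (-2-\<delta>)"
    using assms powr_add[of u 1 "- \<delta>"] powr_add[of u 1 "- 2 - \<delta>"] by simp_all
  have q: "- \<delta> - 1 = - 1 - \<delta>" "- 2 - \<delta> - 1 = - 3 - \<delta>" by simp_all
  show ?thesis
    unfolding kern'_def[abs_def] kern''_def
    apply (rule derivative_eq_intros has_vector_derivative_mult has_vector_derivative_e_sq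
          has_vector_derivative_of_real_powr assms refl)+
    unfolding q
    apply (simp add: p(1) algebra_simps power2_eq_square)
    apply (simp add: p(2) algebra_simps power2_eq_square)
    done
qed

text \<open>The factor 1 - e(u^2) = O(u^2) reduces the singularity of the last term of
  \<open>kern''\<close> from u^(-3 - delta) to u^(-1 - delta). With pi < 4 the coefficients are at
  most 256 and 48 + 48 = 96, rounded up to 300.\<close>

lemma norm_kern''_le:
  assumes "0 < \<delta>" "\<delta> \<le> 1" "u > 0"
  shows "norm (kern'' \<delta> u) \<le> 300 * (u powr (- 1 - \<delta>) + u powr (1 - \<delta>))"
proof -
  have p3: "u powr (- 3 - \<delta>) * u\<^sup>2 = u powr (- 1 - \<delta>)"
    using assms by (simp add: powr_add[symmetric] flip: powr_numeral)
  have "norm (kern'' \<delta> u) \<le>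
      norm (16 * of_real (pi\<^sup>2) * e (u\<^sup>2) * of_real (u powr (1 - \<delta>)))
      + norm (4 * of_real pi * \<i> * e (u\<^sup>2) * of_real ((1 + 2 * \<delta>) * u powr (- 1 - \<delta>)))
      + norm (of_real ((1 + \<delta>) * (2 + \<delta>)) * (1 - e (u\<^sup>2)) * of_real (u powr (- 3 - \<delta>)))"
    unfolding kern''_def by norm
  also have "\<dots> = 16 * pi\<^sup>2 * u powr (1 - \<delta>) + 4 * pi * (1 + 2 * \<delta>) * u powr (- 1 - \<delta>)
      + (1 + \<delta>) * (2 + \<delta>) * norm (1 - e (u\<^sup>2)) * u powr (- 3 - \<delta>)"
    using assms by (simp add: norm_mult norm_power del: of_real_mult of_real_add of_real_power)
  also have "\<dots> \<le> 16 * 4\<^sup>2 * u powr (1 - \<delta>) + 4 * 4 * 3 * u powr (- 1 - \<delta>)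
      + 2 * 3 * (2 * 4 * u\<^sup>2) * u powr (- 3 - \<delta>)"
  proof (intro add_mono mult_mono)
    have "2 * pi * \<bar>u\<^sup>2\<bar> \<le> 2 * 4 * u\<^sup>2"
      using pi_less_4 by (intro mult_mono) auto
    thus "norm (1 - e (u\<^sup>2)) \<le> 2 * 4 * u\<^sup>2"
      using norm_one_minus_e_le[of "u\<^sup>2"] by linarith
    show "pi\<^sup>2 \<le> 4\<^sup>2" using pi_less_4 by (intro power_mono) auto
  qed (use assms pi_less_4 in auto)
  also have "\<dots> = 256 * u powr (1 - \<delta>) + 96 * u powr (- 1 - \<delta>)"
    using p3 by (simp add: algebra_simps)
  also have "\<dots> \<le> 300 * (u powr (- 1 - \<delta>) + u powr (1 - \<delta>))"
    by (simp add: algebra_simps)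
  finally show ?thesis .
qed

section \<open>The primitive of the kernel\<close>

lemma has_real_derivative_powr_shift:
  fixes c x \<delta> :: real
  assumes "c + x > 0" "\<delta> \<noteq> 0"
  shows "((\<lambda>x. - ((c + x) powr (- \<delta>) / \<delta>)) has_real_derivative (c + x) powr (- 1 - \<delta>)) (at x within S)"
proof -
  have "((\<lambda>x. - ((c + x) powr (- \<delta>) / \<delta>)) has_real_derivative (c + x) powr (- 1 - \<delta>)) (at x)"
    using assms by (auto intro!: derivative_eq_intros simp: minus_diff_commute)
  thus ?thesis by (rule DERIV_subset) auto
qed

lemma majorant_nn_integral:
  fixes \<delta> :: real
  assumes "\<delta> > 0"
  shows "(\<integral>\<^sup>+u. ennreal ((1 + u) powr (- 1 - \<delta>)) * indicator {0..} u \<partial>lborel) = 1 / \<delta>"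
proof -
  have "((\<lambda>x. (1 + x) powr (- \<delta>)) \<longlongrightarrow> 0) at_top"
    by (rule tendsto_neg_powr) (use assms in \<open>auto intro!: filterlim_tendsto_add_at_top filterlim_ident\<close>)
  hence "((\<lambda>x. - ((1 + x) powr (- \<delta>) / \<delta>)) \<longlongrightarrow> - (0 / \<delta>)) at_top"
    by (intro tendsto_intros) (use assms in auto)
  hence "(\<integral>\<^sup>+u. ennreal ((1 + u) powr (- 1 - \<delta>)) * indicator {0..} u \<partial>lborel)
      = (- (0 / \<delta>)) - (- ((1 + 0) powr (- \<delta>) / \<delta>))"
    by (intro nn_integral_FTC_atLeast has_real_derivative_powr_shift) (use assms in auto)
  thus ?thesis by simp
qed

lemma e_borel [measurable]: "e \<in> borel_measurable borel"
  unfolding e_def[abs_def] by measurable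

lemma kern_borel [measurable]: "kern \<delta> \<in> borel_measurable borel"
  unfolding kern_def[abs_def] by measurable

lemma kern_nn_integral:
  assumes "0 < \<delta>" "\<delta> \<le> 1"
  shows "(\<integral>\<^sup>+u. ennreal (norm (indicator {0..} u *\<^sub>R kern \<delta> u)) \<partial>lborel) \<le> ennreal (8 * pi / \<delta>)"
proof -
  have "(\<integral>\<^sup>+u. ennreal (norm (indicator {0..} u *\<^sub>R kern \<delta> u)) \<partial>lborel) \<le>
     (\<integral>\<^sup>+u. ennreal (8 * pi) * (ennreal ((1 + u) powr (- 1 - \<delta>)) * indicator {0..} u) \<partial>lborel)"
    by (intro nn_integral_mono)
      (auto simp: indicator_def ennreal_mult[symmetric] intro!: ennreal_leI norm_kern_le assms)
  also have "\<dots> = ennreal (8 * pi) * ennreal (1 / \<delta>)"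
    using majorant_nn_integral[OF assms(1)] by (subst nn_integral_cmult) auto
  also have "\<dots> = ennreal (8 * pi / \<delta>)"
    using assms by (simp flip: ennreal_mult)
  finally show ?thesis .
qed

lemma kern_set_integrable:
  assumes "0 < \<delta>" "\<delta> \<le> 1"
  shows "set_integrable lborel {0..} (kern \<delta>)"
  unfolding set_integrable_def
  using kern_nn_integral[OF assms] by (intro integrableI_bounded) (auto simp: le_less_trans)

lemma kern_set_integrable_subset:
  assumes "0 < \<delta>" "\<delta> \<le> 1" "S \<in> sets borel" "S \<subseteq> {0..}"
  shows "set_integrable lborel S (kern \<delta>)"
  using kern_set_integrable[OF assms(1,2)] by (rule set_integrable_subset) (use assms in auto)

definition kern_integral :: "real \<Rightarrow> complex" where
  "kern_integral \<delta> = (LBINT u:{0..}. kern \<delta> u)"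

definition kern_primitive :: "real \<Rightarrow> real \<Rightarrow> complex" where
  "kern_primitive \<delta> x = (LBINT u:{0..x}. kern \<delta> u)"

lemma norm_kern_integral_le:
  assumes "0 < \<delta>" "\<delta> \<le> 1"
  shows "norm (kern_integral \<delta>) \<le> 8 * pi / \<delta>"
proof -
  have "ennreal (norm (kern_integral \<delta>)) \<le> (\<integral>\<^sup>+u. ennreal (norm (indicator {0..} u *\<^sub>R kern \<delta> u)) \<partial>lborel)"
    using kern_set_integrable[OF assms] integral_norm_bound_ennreal
    unfolding kern_integral_def set_lebesgue_integral_def set_integrable_def by blast
  also have "\<dots> \<le> ennreal (8 * pi / \<delta>)" by (rule kern_nn_integral[OF assms])
  finally show ?thesis using assms by simp
qed

lemma kern_primitive_tendsto:
  assumes "0 < \<delta>" "\<delta> \<le> 1"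
  shows "(kern_primitive \<delta> \<longlongrightarrow> kern_integral \<delta>) at_top"
  unfolding kern_primitive_def[abs_def] kern_integral_def
  by (rule tendsto_set_lebesgue_integral_at_top) (use kern_set_integrable[OF assms] in auto)

lemma norm_kern_primitive_le:
  assumes "0 < \<delta>" "\<delta> \<le> 1" "x \<ge> 0"
  shows "norm (kern_primitive \<delta> x) \<le> 8 * pi * x"
proof -
  have int: "integrable lborel (\<lambda>u. indicator {0..x} u *\<^sub>R kern \<delta> u)"
    using kern_set_integrable_subset[OF assms(1,2), of "{0..x}"] by (auto simp: set_integrable_def)
  have "norm (kern_primitive \<delta> x) \<le> (LBINT u. norm (indicator {0..x} u *\<^sub>R kern \<delta> u))"
    unfolding kern_primitive_def set_lebesgue_integral_def by (rule integral_norm_bound)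
  also have "\<dots> \<le> (LBINT u:{0..x}. 8 * pi)"
    unfolding set_lebesgue_integral_def
  proof (rule integral_mono[OF integrable_norm[OF int]])
    show "integrable lborel (\<lambda>u. indicator {0..x} u *\<^sub>R (8 * pi))"
      by (intro integrable_scaleR_left integrable_real_indicator) (use assms in auto)
  qed (use norm_kern_le_const[OF assms(1,2)] in \<open>auto simp: indicator_def\<close>)
  also have "\<dots> = 8 * pi * x" using assms by (simp add: set_lebesgue_integral_def)
  finally show ?thesis .
qed

text \<open>The fundamental theorem needs a continuous integrand, but for delta = 1 the kernel jumps
  at 0. It is therefore applied from a = x / 2 > 0, and the part over \<open>{0..a}\<close> is a
  constant.\<close>

lemma kern_primitive_has_vector_derivative:
  assumes "0 < \<delta>" "\<delta> \<le> 1" "x > 0"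
  shows "(kern_primitive \<delta> has_vector_derivative kern \<delta> x) (at x within S)"
proof -
  define a where "a = x / 2"
  have a: "0 < a" "a < x" using assms by (auto simp: a_def)
  have cont: "continuous_on {a..x+1} (kern \<delta>)"
    by (intro continuous_at_imp_continuous_on ballI
          has_vector_derivative_continuous[OF kern_has_vector_derivative]) (use a in auto)
  have "((\<lambda>y. kern_primitive \<delta> a + integral {a..y} (kern \<delta>)) has_vector_derivative 0 + kern \<delta> x) (at x within {a..x+1})"
    by (intro derivative_intros integral_has_vector_derivative[OF cont]) (use a in auto)
  hence "((\<lambda>y. kern_primitive \<delta> a + integral {a..y} (kern \<delta>)) has_vector_derivative kern \<delta> x) (at x within {a<..<x+1})"
    by (auto intro: has_vector_derivative_within_subset)
  hence "((\<lambda>y. kern_primitive \<delta> a + integral {a..y} (kern \<delta>)) has_vector_derivative kern \<delta> x) (at x)"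
    using a by (subst (asm) at_within_open) auto
  hence "(kern_primitive \<delta> has_vector_derivative kern \<delta> x) (at x)"
  proof (rule has_vector_derivative_transform_within_open[where S = "{a<..}"])
    fix y assume y: "y \<in> {a<..}"
    have "integral {a..y} (kern \<delta>) = (LBINT u:{a..y}. kern \<delta> u)"
      by (rule set_borel_integral_eq_integral(2)[symmetric], rule kern_set_integrable_subset)
        (use assms a in auto)
    also have "\<dots> = (LBINT u:{a<..y}. kern \<delta> u)"
      by (rule set_integral_discrete_difference[where X = "{a}"]) auto
    also have "kern_primitive \<delta> a + \<dots> = (LBINT u:{0..a} \<union> {a<..y}. kern \<delta> u)"
      unfolding kern_primitive_def
      by (rule set_integral_Un[symmetric]; (rule kern_set_integrable_subset)?) (use assms a in auto)
    also have "{0..a} \<union> {a<..y} = {0..y}" using a y by auto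
    finally show "kern_primitive \<delta> a + integral {a..y} (kern \<delta>) = kern_primitive \<delta> y"
      by (simp add: kern_primitive_def)
  qed (use a in auto)
  thus ?thesis by (rule has_vector_derivative_at_within)
qed

section \<open>Mean value bound, trapezoidal rule and the tail of the integral\<close>

lemma vector_mean_value_bound:
  fixes f :: "real \<Rightarrow> complex"
  assumes "a \<le> b"
    and "\<And>x. x \<in> {a..b} \<Longrightarrow> (f has_vector_derivative f' x) (at x)"
    and "\<And>x. x \<in> {a..b} \<Longrightarrow> norm (f' x) \<le> B"
  shows "norm (f b - f a) \<le> B * (b - a)"
proof (cases "a = b")
  case False
  have "norm (f b - f a) \<le> B * b - B * a"
  proof (rule differentiable_bound_general[where f' = f' and \<phi>' = "\<lambda>_. B"])
    show "continuous_on {a..b} f"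
      by (intro continuous_at_imp_continuous_on ballI has_vector_derivative_continuous[OF assms(2)])
    show "((*) B has_vector_derivative B) (at x)" for x
      by (auto intro!: derivative_eq_intros simp flip: has_real_derivative_iff_has_vector_derivative)
  qed (use False assms in \<open>auto intro!: continuous_intros\<close>)
  thus ?thesis by (simp add: algebra_simps)
qed auto

text \<open>As a function of the right endpoint y, the error has derivative (f y - f a - (y - a) f'
  y) / 2, and the bracket has derivative -(y - a) f'' y. Both vanish at y = a, so two mean value
  bounds give H^3 M; the sharp constant 1/12 is not aimed at.\<close>

lemma trapezoid_error:
  fixes F :: "real \<Rightarrow> complex"
  assumes "a \<le> b"
    and F: "\<And>x. x \<in> {a..b} \<Longrightarrow> (F has_vector_derivative f x) (at x)"
    and f: "\<And>x. x \<in> {a..b} \<Longrightarrow> (f has_vector_derivative f' x) (at x)"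
    and f': "\<And>x. x \<in> {a..b} \<Longrightarrow> (f' has_vector_derivative f'' x) (at x)"
    and M: "\<And>x. x \<in> {a..b} \<Longrightarrow> norm (f'' x) \<le> M"
  shows "norm (F b - F a - ((b - a) / 2) *\<^sub>R (f a + f b)) \<le> M * (b - a) ^ 3"
proof -
  define H where "H = b - a"
  have M0: "M \<ge> 0" using M[of a] \<open>a \<le> b\<close> norm_ge_zero[of "f'' a"]
    by (metis atLeastAtMost_iff order_refl order_trans)
  have R: "norm (f y - f a - (y - a) *\<^sub>R f' y) \<le> M * H * H" if y: "y \<in> {a..b}" for y
  proof -
    have "norm ((f y - (y - a) *\<^sub>R f' y) - (f a - (a - a) *\<^sub>R f' a)) \<le> M * H * (y - a)"
    proof (rule vector_mean_value_bound[where f' = "\<lambda>x. - (x - a) *\<^sub>R f'' x"])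
      fix x assume x: "x \<in> {a..y}"
      hence xab: "x \<in> {a..b}" using y by auto
      show "((\<lambda>x. f x - (x - a) *\<^sub>R f' x) has_vector_derivative - (x - a) *\<^sub>R f'' x) (at x)"
        by (rule derivative_eq_intros f[OF xab] f'[OF xab] refl
              has_real_derivative_iff_has_vector_derivative[THEN iffD2])+ (simp add: algebra_simps)
      have "(x - a) * norm (f'' x) \<le> H * M"
        using M[OF xab] M0 x y by (intro mult_mono) (auto simp: H_def)
      thus "norm (- (x - a) *\<^sub>R f'' x) \<le> M * H" using x by (simp add: mult_ac)
    qed (use y in auto)
    also have "\<dots> \<le> M * H * H" using y M0 by (intro mult_left_mono) (auto simp: H_def)
    finally show ?thesis by (simp add: algebra_simps)
  qed
  have "norm ((F b - ((b - a) / 2) *\<^sub>R (f a + f b)) - (F a - ((a - a) / 2) *\<^sub>R (f a + f a))) \<le> (M * H * H) * (b - a)"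
  proof (rule vector_mean_value_bound[where f' = "\<lambda>y. (1 / 2) *\<^sub>R (f y - f a - (y - a) *\<^sub>R f' y)"])
    fix x assume x: "x \<in> {a..b}"
    show "((\<lambda>y. F y - ((y - a) / 2) *\<^sub>R (f a + f y)) has_vector_derivative
        (1 / 2) *\<^sub>R (f x - f a - (x - a) *\<^sub>R f' x)) (at x)"
    proof -
      have "((\<lambda>y. (y - a) / 2) has_real_derivative 1 / 2) (at x)"
        by (auto intro!: derivative_eq_intros)
      from has_vector_derivative_diff[OF F[OF x] has_vector_derivative_scaleR[OF this
            has_vector_derivative_add[OF has_vector_derivative_const f[OF x]]]]
      show ?thesis by (rule has_vector_derivative_eq_rhs) (simp add: scaleR_conv_of_real field_simps)
    qed
    have "0 \<le> M * H * H" using M0 \<open>a \<le> b\<close> by (simp add: H_def)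
    thus "norm ((1 / 2) *\<^sub>R (f x - f a - (x - a) *\<^sub>R f' x)) \<le> M * H * H" using R[OF x] by simp
  qed (use \<open>a \<le> b\<close> in auto)
  thus ?thesis by (simp add: algebra_simps H_def power3_eq_cube)
qed

text \<open>Mean value theorem for the primitive -x^(-delta) / delta. The two inequalities let sums
  of the monotone part telescope from either side.\<close>

lemma powr_step_bounds:
  fixes x H \<delta> :: real
  assumes "0 < x" "0 < H" "0 < \<delta>"
  shows "H * (x + H) powr (- 1 - \<delta>) \<le> (x powr (- \<delta>) - (x + H) powr (- \<delta>)) / \<delta>"
    and "(x powr (- \<delta>) - (x + H) powr (- \<delta>)) / \<delta> \<le> H * x powr (- 1 - \<delta>)"
proof -
  have "\<exists>z. x < z \<and> z < x + H \<and>
      - ((0 + (x + H)) powr (- \<delta>) / \<delta>) - (- ((0 + x) powr (- \<delta>) / \<delta>)) = (x + H - x) * (0 + z) powr (- 1 - \<delta>)"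
    by (rule MVT2, use assms in simp, rule has_real_derivative_powr_shift) (use assms in auto)
  then obtain z where z: "x < z" "z < x + H"
    and eq: "(x powr (- \<delta>) - (x + H) powr (- \<delta>)) / \<delta> = H * z powr (- 1 - \<delta>)"
    by (auto simp: diff_divide_distrib)
  show "H * (x + H) powr (- 1 - \<delta>) \<le> (x powr (- \<delta>) - (x + H) powr (- \<delta>)) / \<delta>"
    and "(x powr (- \<delta>) - (x + H) powr (- \<delta>)) / \<delta> \<le> H * x powr (- 1 - \<delta>)"
    unfolding eq using z assms by (auto intro!: mult_left_mono powr_antimono_base)
qed

lemma kern_integral_tail:
  assumes "0 < \<delta>" "\<delta> \<le> 1" "0 < U"
  shows "norm (kern_integral \<delta> - kern_primitive \<delta> U - of_real (U powr (- \<delta>) / \<delta>)) \<le> U powr (- 2 - \<delta>)"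
proof -
  \<comment> \<open>The second summand removes the monotone part of the kernel, the third is the
    boundary term of one partial integration. What remains of the derivative is O(x^(-3 - delta)),
    hence absolutely integrable, and \<open>\<Psi>\<close> has the limit
    \<open>kern_integral\<close> at infinity.\<close>
  define \<Psi> where "\<Psi> = (\<lambda>x. kern_primitive \<delta> x + of_real (x powr (- \<delta>)) / of_real \<delta>
      + e (x\<^sup>2) * of_real (x powr (- 2 - \<delta>)) / (4 * of_real pi * \<i>))"
  have d: "(\<Psi> has_vector_derivative - (of_real (2 + \<delta>) * e (x\<^sup>2) * of_real (x powr (- 3 - \<delta>)) / (4 * of_real pi * \<i>))) (at x)"
    if x: "x > 0" for x
  proof -
    have p: "x powr (- 1 - \<delta>) = x * x powr (- 2 - \<delta>)" using x powr_add[of x 1 "- 2 - \<delta>"] by simp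
    have q: "- \<delta> - 1 = - 1 - \<delta>" "- 2 - \<delta> - 1 = - 3 - \<delta>" by simp_all
    show ?thesis unfolding \<Psi>_def
      apply (rule derivative_eq_intros has_vector_derivative_mult has_vector_derivative_e_sq
          has_vector_derivative_divide
          has_vector_derivative_of_real_powr kern_primitive_has_vector_derivative x assms refl)+
      unfolding q
      using assms by (simp add: kern_eq p field_simps)
  qed
  have step: "norm (\<Psi> X - \<Psi> U) \<le> U powr (- 2 - \<delta>) / (4 * pi)" if X: "X > U" for X
  proof -
    have "norm (\<Psi> X - \<Psi> U) \<le> - (X powr (- 2 - \<delta>) / (4 * pi)) - (- (U powr (- 2 - \<delta>) / (4 * pi)))"
    proof (rule differentiable_bound_general[OF X _ _ d])
      show "continuous_on {U..X} \<Psi>"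
        using assms by (intro continuous_at_imp_continuous_on ballI has_vector_derivative_continuous[OF d]) auto
      show "continuous_on {U..X} (\<lambda>x. - (x powr (- 2 - \<delta>) / (4 * pi)))"
        using assms by (intro continuous_intros) auto
      fix x assume x: "U < x"
      have q: "- 2 - \<delta> - 1 = - 3 - \<delta>" by simp
      show "((\<lambda>x. - (x powr (- 2 - \<delta>) / (4 * pi))) has_vector_derivative (2 + \<delta>) * x powr (- 3 - \<delta>) / (4 * pi)) (at x)"
        unfolding has_real_derivative_iff_has_vector_derivative[symmetric] q[symmetric]
        using x assms by (auto intro!: derivative_eq_intros simp: field_simps)
      show "norm (- (of_real (2 + \<delta>) * e (x\<^sup>2) * of_real (x powr (- 3 - \<delta>)) / (4 * of_real pi * \<i>)) :: complex)
           \<le> (2 + \<delta>) * x powr (- 3 - \<delta>) / (4 * pi)"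
        using assms by (simp add: norm_mult norm_divide del: of_real_add)
    qed (use assms in auto)
    also have "\<dots> \<le> U powr (- 2 - \<delta>) / (4 * pi)" by simp
    finally show ?thesis .
  qed
  have "((\<lambda>x. x powr (- \<delta>)) \<longlongrightarrow> 0) at_top" "((\<lambda>x::real. x powr (- 2 - \<delta>)) \<longlongrightarrow> 0) at_top"
    by (rule tendsto_neg_powr; use assms in \<open>auto intro: filterlim_ident\<close>)+
  note lims = this
  have "((\<lambda>x. of_real (x powr (- \<delta>)) / of_real \<delta> :: complex) \<longlongrightarrow> of_real 0 / of_real \<delta>) at_top"
    by (intro tendsto_intros lims) (use assms in auto)
  moreover have "((\<lambda>x. e (x\<^sup>2) * of_real (x powr (- 2 - \<delta>)) / (4 * of_real pi * \<i>)) \<longlongrightarrow> 0) at_top"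
  proof (rule Lim_null_comparison)
    show "((\<lambda>x::real. x powr (- 2 - \<delta>) / (4 * pi)) \<longlongrightarrow> 0) at_top"
      using tendsto_divide[OF lims(2) tendsto_const[of "4 * pi"]] by simp
  qed (simp add: norm_mult norm_divide)
  ultimately have "(\<Psi> \<longlongrightarrow> kern_integral \<delta> + of_real 0 / of_real \<delta> + 0) at_top"
    unfolding \<Psi>_def by (intro tendsto_add kern_primitive_tendsto assms)
  hence "((\<lambda>X. norm (\<Psi> X - \<Psi> U)) \<longlongrightarrow> norm (kern_integral \<delta> - \<Psi> U)) at_top"
    by (intro tendsto_intros) auto
  hence *: "norm (kern_integral \<delta> - \<Psi> U) \<le> U powr (- 2 - \<delta>) / (4 * pi)"
    by (rule tendsto_upperbound) (use step in \<open>auto intro: eventually_mono[OF eventually_gt_at_top[of U]]\<close>)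
  have "kern_integral \<delta> - kern_primitive \<delta> U - of_real (U powr (- \<delta>) / \<delta>) =
     (kern_integral \<delta> - \<Psi> U) + e (U\<^sup>2) * of_real (U powr (- 2 - \<delta>)) / (4 * of_real pi * \<i>)"
    by (simp add: \<Psi>_def)
  also have "norm \<dots> \<le> U powr (- 2 - \<delta>) / (4 * pi) + U powr (- 2 - \<delta>) / (4 * pi)"
    by (rule norm_triangle_le, rule add_mono[OF *]) (simp add: norm_mult norm_divide)
  also have "\<dots> = U powr (- 2 - \<delta>) * (1 / (2 * pi))" by simp
  also have "\<dots> \<le> U powr (- 2 - \<delta>) * 1"
    using pi_ge_two by (intro mult_left_mono) auto
  finally show ?thesis by simp
qed

section \<open>Kusmin-Landau estimates\<close>

text \<open>Abel summation: each drop w m - w (m + 1) costs its own size, and the drops add up to at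
  most w 0. Carrying the boundary term w k a (k + 1) through the induction reduces the step to a
  single drop.\<close>

lemma antitone_weight_telescope:
  fixes w :: "nat \<Rightarrow> real" and a :: "nat \<Rightarrow> complex"
  assumes anti: "\<And>m. m < n \<Longrightarrow> w (Suc m) \<le> w m"
    and nonneg: "\<And>m. m \<le> n \<Longrightarrow> 0 \<le> w m"
    and a: "\<And>m. norm (a m) \<le> 1"
  shows "norm (\<Sum>m\<le>n. of_real (w m) * (a m - a (Suc m))) \<le> 2 * w 0"
proof -
  have le: "norm (of_real (w m) * a k) \<le> w m" if "m \<le> n" for m k
    using nonneg[OF that] a[of k] by (simp add: norm_mult mult_left_le)
  have *: "norm ((\<Sum>m\<le>k. of_real (w m) * (a m - a (Suc m))) + of_real (w k) * a (Suc k)) \<le> 2 * w 0 - w k"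
    if "k \<le> n" for k
    using that
  proof (induction k)
    case 0
    thus ?case using le[of 0 0] by (simp add: algebra_simps)
  next
    case (Suc k)
    let ?Q = "\<lambda>k. (\<Sum>m\<le>k. of_real (w m) * (a m - a (Suc m))) + of_real (w k) * a (Suc k)"
    have "?Q (Suc k) = ?Q k - of_real (w k - w (Suc k)) * a (Suc k)"
      by (simp add: algebra_simps)
    also have "norm \<dots> \<le> norm (?Q k) + norm (of_real (w k - w (Suc k)) * a (Suc k))"
      by (rule norm_triangle_ineq4)
    also have "\<dots> \<le> (2 * w 0 - w k) + (w k - w (Suc k)) * 1"
      unfolding norm_mult norm_of_real using Suc anti[of k] a[of "Suc k"]
      by (intro add_mono mult_mono) auto
    finally show ?case by simp
  qed
  have "norm (\<Sum>m\<le>n. of_real (w m) * (a m - a (Suc m)))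
      = norm (((\<Sum>m\<le>n. of_real (w m) * (a m - a (Suc m))) + of_real (w n) * a (Suc n)) - of_real (w n) * a (Suc n))"
    by simp
  also have "\<dots> \<le> (2 * w 0 - w n) + w n"
    using *[of n] le[of n "Suc n"] by (intro norm_triangle_le_diff add_mono) auto
  finally show ?thesis by simp
qed

lemma cot_antimono:
  assumes "0 < x" "x \<le> y" "y < pi"
  shows "cot y \<le> cot (x::real)"
proof -
  have s: "sin x > 0" "sin y > 0" using assms by (auto intro!: sin_gt_zero)
  have "sin (y - x) \<ge> 0" using assms by (intro sin_ge_zero) auto
  hence "cos y * sin x \<le> cos x * sin y" by (simp add: sin_diff mult_ac)
  thus ?thesis using s by (simp add: cot_def field_simps)
qed

lemma cot_le_inverse:
  assumes "0 < x" "x < pi"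
  shows "cot x \<le> 1 / (x::real)"
proof -
  have "sin 0 - 0 * cos 0 \<le> sin x - x * cos x"
  proof (rule DERIV_nonneg_imp_nondecreasing[where f = "\<lambda>x. sin x - x * cos x"])
    fix t :: real assume t: "0 \<le> t" "t \<le> x"
    have "((\<lambda>x. sin x - x * cos x) has_real_derivative t * sin t) (at t)"
      by (auto intro!: derivative_eq_intros)
    moreover have "t * sin t \<ge> 0" using t assms by (intro mult_nonneg_nonneg sin_ge_zero) auto
    ultimately show "\<exists>y. ((\<lambda>x. sin x - x * cos x) has_real_derivative y) (at t) \<and> 0 \<le> y" by blast
  qed (use assms in auto)
  moreover have "sin x > 0" using assms by (intro sin_gt_zero) auto
  ultimately show ?thesis using assms by (simp add: cot_def field_simps)
qed

lemma cot_pi_minus: "cot (pi - x) = - cot (x::real)"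
  by (simp add: cot_def)

text \<open>Product form of 1 / (1 - e x) = (1 + i cot(pi x)) / 2. The real part is constant and the
  imaginary part monotone in x, which is what partial summation needs.\<close>

lemma one_minus_e_mult:
  assumes "sin (pi * x) \<noteq> 0"
  shows "(1 - e x) * (1 / 2 + \<i> / 2 * of_real (cot (pi * x))) = 1"
proof -
  let ?s = "sin (pi * x)" and ?c = "cos (pi * x)"
  have "1 - e x = 2 * of_real ?s * (of_real ?s - \<i> * of_real ?c)"
    using cos_double_sin[of "pi * x"] sin_double[of "pi * x"]
    by (simp add: e_eq_cis complex_eq_iff mult_ac power2_eq_square)
  moreover have "1 / 2 + \<i> / 2 * of_real (cot (pi * x)) = (of_real ?s + \<i> * of_real ?c) / (2 * of_real ?s)"
    using assms by (simp add: cot_def field_simps)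
  moreover have "(of_real ?s - \<i> * of_real ?c) * (of_real ?s + \<i> * of_real ?c) = 1"
    using sin_cos_squared_add[of "pi * x"] by (simp add: complex_eq_iff power2_eq_square)
  moreover have "2 * x * y * (z / (2 * x)) = y * z" if "x \<noteq> 0" for x y z :: complex
    using that by simp
  ultimately show ?thesis using assms by simp
qed

text \<open>Since a m - a (m + 1) = a m (1 - e(beta m)), each a m is this difference times (1 + i
  cot(pi beta m)) / 2. The weights v and v (cot + K) are nonnegative and antitone, so Abel summation
  applies to both. The shift K makes the cotangent nonnegative when beta passes 1/2, and removing it
  again costs K times the bound for v.\<close>

lemma kusmin_landau:
  fixes v \<beta> :: "nat \<Rightarrow> real" and a :: "nat \<Rightarrow> complex"
  assumes a: "\<And>m. norm (a m) \<le> 1" "\<And>m. a (Suc m) = a m * e (\<beta> m)"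
    and \<beta>: "\<And>m. m \<le> n \<Longrightarrow> 0 < \<beta> m" "\<And>m. m \<le> n \<Longrightarrow> \<beta> m < 1"
      "\<And>m. m < n \<Longrightarrow> \<beta> m \<le> \<beta> (Suc m)"
    and v: "\<And>m. m \<le> n \<Longrightarrow> 0 \<le> v m" "\<And>m. m < n \<Longrightarrow> v (Suc m) \<le> v m"
    and K: "0 \<le> K" "\<And>m. m \<le> n \<Longrightarrow> 0 \<le> cot (pi * \<beta> m) + K"
  shows "norm (\<Sum>m\<le>n. of_real (v m) * a m) \<le> v 0 * (1 + cot (pi * \<beta> 0) + 2 * K)"
proof -
  define w where "w m = v m * (cot (pi * \<beta> m) + K)" for m
  define A where "A = (\<Sum>m\<le>n. of_real (v m) * (a m - a (Suc m)))"
  define B where "B = (\<Sum>m\<le>n. of_real (w m) * (a m - a (Suc m)))"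
  have split: "of_real (v m) * a m = 1 / 2 * (of_real (v m) * (a m - a (Suc m)))
      + \<i> / 2 * (of_real (w m) * (a m - a (Suc m)))
      - \<i> / 2 * of_real K * (of_real (v m) * (a m - a (Suc m)))" if "m \<le> n" for m
  proof -
    define D where "D = a m - a (Suc m)"
    have "sin (pi * \<beta> m) > 0" using \<beta>(1,2)[OF that] by (intro sin_gt_zero) auto
    hence "a m * ((1 - e (\<beta> m)) * (1 / 2 + \<i> / 2 * of_real (cot (pi * \<beta> m)))) = a m"
      using one_minus_e_mult[of "\<beta> m"] by simp
    moreover have "a m * (1 - e (\<beta> m)) = a m - a (Suc m)" by (simp add: a(2) right_diff_distrib)
    ultimately have "(a m - a (Suc m)) * (1 / 2 + \<i> / 2 * of_real (cot (pi * \<beta> m))) = a m"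
      by (metis mult.assoc)
    hence "of_real (v m) * a m = of_real (v m) * (D * (1 / 2 + \<i> / 2 * of_real (cot (pi * \<beta> m))))"
      by (simp add: D_def)
    also have "\<dots> = 1 / 2 * (of_real (v m) * D) + \<i> / 2 * (of_real (w m) * D)
        - \<i> / 2 * of_real K * (of_real (v m) * D)"
      by (simp add: w_def algebra_simps)
    finally show ?thesis by (simp add: D_def)
  qed
  have A: "norm A \<le> 2 * v 0" unfolding A_def
    by (rule antitone_weight_telescope) (use v a in auto)
  have B: "norm B \<le> 2 * w 0" unfolding B_def
  proof (rule antitone_weight_telescope)
    fix m assume m: "m < n"
    have "cot (pi * \<beta> (Suc m)) \<le> cot (pi * \<beta> m)"
      using \<beta>(1)[of "Suc m"] \<beta>(2)[of m] \<beta>(3)[of m] \<beta>(2)[of "Suc m"] \<beta>(1)[of m] m by (intro cot_antimono) auto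
    thus "w (Suc m) \<le> w m" unfolding w_def
      using v(1)[of m] v(2)[of m] K(1) K(2)[of "Suc m"] m by (intro mult_mono) auto
  qed (use v K a in \<open>auto simp: w_def\<close>)
  have "(\<Sum>m\<le>n. of_real (v m) * a m) = 1 / 2 * A + \<i> / 2 * B - \<i> / 2 * of_real K * A"
    unfolding A_def B_def sum_distrib_left sum.distrib[symmetric] sum_subtractf[symmetric]
    by (intro sum.cong refl, rule split) auto
  also have "norm \<dots> \<le> norm (1 / 2 * A) + norm (\<i> / 2 * B) + norm (\<i> / 2 * of_real K * A)"
    by (rule order_trans[OF norm_triangle_ineq4 add_right_mono[OF norm_triangle_ineq]])
  also have "\<dots> = 1 / 2 * norm A + 1 / 2 * norm B + 1 / 2 * K * norm A"
    using K by (simp add: norm_mult norm_divide)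
  also have "\<dots> \<le> 1 / 2 * (2 * v 0) + 1 / 2 * (2 * w 0) + 1 / 2 * K * (2 * v 0)"
    using A B K by (intro add_mono mult_left_mono) auto
  also have "\<dots> = v 0 * (1 + cot (pi * \<beta> 0) + 2 * K)" by (simp add: w_def algebra_simps)
  finally show ?thesis .
qed

lemma nat_convex_set_cases:
  fixes S :: "nat set"
  assumes "finite S" and "\<And>x y z. x \<in> S \<Longrightarrow> z \<in> S \<Longrightarrow> x \<le> y \<Longrightarrow> y \<le> z \<Longrightarrow> y \<in> S"
  shows "S = {} \<or> (\<exists>p n. S = (+) p ` {..n})"
proof (cases "S = {}")
  case False
  have "S = {Min S..Max S}"
    using assms(1) False assms(2)[OF Min_in Max_in] by (intro equalityI subsetI) auto
  also have "\<dots> = {Min S + 0..Min S + (Max S - Min S)}"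
    using assms(1) False by simp
  also have "\<dots> = (+) (Min S) ` {0..Max S - Min S}"
    by (subst image_add_atLeastAtMost) simp
  finally show ?thesis unfolding atMost_atLeast0 by blast
qed simp

text \<open>Form fitted to blocks cut out by conditions on the monotone \<open>\<beta>\<close>,
  which are intervals of indices. The integer j drops out of \<open>e\<close>; l is the distance
  kept from the resonance j below, while K accounts for the approach to j + 1.\<close>

lemma kusmin_landau_set:
  fixes v \<beta> :: "nat \<Rightarrow> real" and a :: "nat \<Rightarrow> complex" and j :: int and l :: real
  assumes S: "finite S" "\<And>x y z. x \<in> S \<Longrightarrow> z \<in> S \<Longrightarrow> x \<le> y \<Longrightarrow> y \<le> z \<Longrightarrow> y \<in> S"
    and a: "\<And>m. norm (a m) \<le> 1" "\<And>m. a (Suc m) = a m * e (\<beta> m)"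
    and \<beta>: "mono \<beta>" "0 < l" "\<And>m. m \<in> S \<Longrightarrow> j + l \<le> \<beta> m" "\<And>m. m \<in> S \<Longrightarrow> \<beta> m < of_int j + 1"
    and v: "antimono v" "\<And>m. 0 \<le> v m" "\<And>m. m \<in> S \<Longrightarrow> v m \<le> B" "0 \<le> B"
    and K: "0 \<le> K" "\<And>m. m \<in> S \<Longrightarrow> 0 \<le> cot (pi * (\<beta> m - j)) + K"
  shows "norm (\<Sum>m\<in>S. of_real (v m) * a m) \<le> B * (1 + 1 / (pi * l) + 2 * K)"
proof -
  have "S = {} \<or> (\<exists>p n. S = (+) p ` {..n})"
    by (rule nat_convex_set_cases[OF S(1)]) (rule S(2))
  thus ?thesis
  proof (elim disjE exE)
    assume "S = {}"
    thus ?thesis using v \<beta> K by simp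
  next
    fix p n assume 2: "S = (+) p ` {..n}"
    have pS: "p + m \<in> S" if "m \<le> n" for m using that 2 by auto
    have "(\<Sum>m\<in>S. of_real (v m) * a m) = (\<Sum>m\<le>n. of_real (v (p + m)) * a (p + m))"
      unfolding 2 by (subst sum.reindex) auto
    also have "norm \<dots> \<le> v (p + 0) * (1 + cot (pi * (\<beta> (p + 0) - j)) + 2 * K)"
    proof (rule kusmin_landau)
      fix m
      show "a (p + Suc m) = a (p + m) * e (\<beta> (p + m) - j)"
        using a(2)[of "p + m"] e_add[of "\<beta> (p + m) - j" "of_int j"] by simp
      show "\<beta> (p + m) - j \<le> \<beta> (p + Suc m) - j" using monoD[OF \<beta>(1), of "p + m" "p + Suc m"] by simp
      show "v (p + Suc m) \<le> v (p + m)" using antimonoD[OF v(1), of "p + m" "p + Suc m"] by simp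
    next
      fix m assume "m \<le> n"
      from pS[OF this] show "0 < \<beta> (p + m) - j" "\<beta> (p + m) - j < 1" "0 \<le> cot (pi * (\<beta> (p + m) - j)) + K"
        using \<beta>(2-4) K by force+
    qed (use a v K in auto)
    also have "\<dots> \<le> B * (1 + 1 / (pi * l) + 2 * K)"
    proof (intro mult_mono add_mono order_refl)
      have p: "p \<in> S" using pS[of 0] by simp
      have "cot (pi * (\<beta> (p + 0) - j)) \<le> cot (pi * l)"
        using \<beta>(2) \<beta>(3)[OF p] \<beta>(4)[OF p] by (intro cot_antimono) auto
      also have "\<dots> \<le> 1 / (pi * l)"
        using \<beta>(2) \<beta>(3)[OF p] \<beta>(4)[OF p] by (intro cot_le_inverse) auto
      finally show "cot (pi * (\<beta> (p + 0) - j)) \<le> 1 / (pi * l)" .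
      show "0 \<le> 1 + cot (pi * (\<beta> (p + 0) - j)) + 2 * K" using K(1) K(2)[OF p] by simp
      show "v (p + 0) \<le> B" using v(3)[OF p] by simp
    qed (use v K in auto)
    finally show ?thesis .
  qed
qed

section \<open>The oscillating sum, block by block around its resonances\<close>

lemma summable_powr_Suc:
  fixes \<delta> :: real
  assumes "\<delta> > 0"
  shows "summable (\<lambda>j. real (Suc j) powr (- 1 - \<delta>))"
  using assms summable_real_powr_iff[of "- 1 - \<delta>"] by (subst summable_Suc_iff) auto

text \<open>This is zeta(1 + delta). It collects both the trapezoidal errors near 0 and the
  contributions of the resonances.\<close>

definition zsum :: "real \<Rightarrow> real" where
  "zsum \<delta> = (\<Sum>j. real (Suc j) powr (- 1 - \<delta>))"

lemma sum_le_zsum: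
  assumes "\<delta> > 0"
  shows "(\<Sum>j<n. real (Suc j) powr (- 1 - \<delta>)) \<le> zsum \<delta>"
  unfolding zsum_def by (intro sum_le_suminf summable_powr_Suc assms) auto

lemma zsum_nonneg: "\<delta> > 0 \<Longrightarrow> 0 \<le> zsum \<delta>"
  using sum_le_zsum[of \<delta> 0] by simp

lemma oscillating_sum_bound:
  fixes \<delta> H U :: real
  assumes \<delta>: "0 < \<delta>" "\<delta> \<le> 1" and H: "0 < H" "H \<le> 1 / 2" and U: "1 \<le> U" "1 \<le> U\<^sup>2 * H"
  shows "norm (\<Sum>m<M. of_real ((U + real m * H) powr (- 1 - \<delta>)) * e ((U + real m * H)\<^sup>2)) \<le> 2 + 384 * zsum \<delta>"
proof -
  define u where "u m = U + real m * H" for m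
  define v where "v m = u m powr (- 1 - \<delta>)" for m
  define a where "a m = e ((u m)\<^sup>2)" for m
  \<comment> \<open>\<open>\<beta> m\<close> is the phase increment (u + H)^2 - u^2 at u = u m, and
    \<open>g m\<close> the integer nearest to it, so the blocks of constant \<open>g\<close> are
    centred at the resonances.\<close>
  define \<beta> where "\<beta> m = 2 * H * u m + H\<^sup>2" for m
  define g where "g m = nat \<lfloor>\<beta> m + 1 / 2\<rfloor>" for m
  have u_ge: "u m \<ge> U" for m using H by (simp add: u_def)
  have u_pos: "u m > 0" for m using u_ge[of m] U by simp
  have \<beta>_ge: "\<beta> m \<ge> 2 * H * U" for m
    unfolding \<beta>_def using H u_ge[of m] by (intro order_trans[OF mult_left_mono[of U "u m"]]) auto
  have HU: "0 < 2 * H * U" using H U by simp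
  have \<beta>_pos: "\<beta> m > 0" for m using \<beta>_ge[of m] HU by linarith
  have mono: "mono \<beta>"
    unfolding \<beta>_def u_def by (intro monoI add_mono mult_left_mono mult_right_mono) (use H in auto)
  have anti: "antimono v"
    unfolding v_def u_def
    by (intro antimonoI powr_mono2') (use H U \<delta> in \<open>auto simp: add_pos_nonneg mult_right_mono\<close>)
  have v0: "0 \<le> v m" for m by (simp add: v_def)
  have a1: "norm (a m) \<le> 1" for m by (simp add: a_def)
  have a2: "a (Suc m) = a m * e (\<beta> m)" for m
    unfolding a_def \<beta>_def e_add[symmetric]
    by (rule arg_cong[of _ _ e]) (simp add: u_def power2_eq_square algebra_simps)
  have KL: "norm (\<Sum>m\<in>S. of_real (v m) * a m) \<le> B * (1 + 1 / (pi * l) + 2 * K)"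
    if "finite S" "\<And>x y z. x \<in> S \<Longrightarrow> z \<in> S \<Longrightarrow> x \<le> y \<Longrightarrow> y \<le> z \<Longrightarrow> y \<in> S"
      "0 < l" "\<And>m. m \<in> S \<Longrightarrow> of_int j + l \<le> \<beta> m" "\<And>m. m \<in> S \<Longrightarrow> \<beta> m < of_int j + 1"
      "\<And>m. m \<in> S \<Longrightarrow> v m \<le> B" "0 \<le> B" "0 \<le> K"
      "\<And>m. m \<in> S \<Longrightarrow> 0 \<le> cot (pi * (\<beta> m - of_int j)) + K" for S B l K and j :: int
    by (rule kusmin_landau_set[OF that(1) _ a1 a2 mono that(3) _ _ anti v0 _ that(7,8)]; (rule that; assumption))
  have g_iff: "g m = j \<longleftrightarrow> real j - 1 / 2 \<le> \<beta> m \<and> \<beta> m < real j + 1 / 2" for m j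
    unfolding g_def using \<beta>_pos[of m] by (subst nat_eq_iff) (auto simp: floor_eq_iff)

  \<comment> \<open>No resonance here except 0, from which the increment keeps the distance l = 2 H
    U; it stays below 1/2, so the cotangent is nonnegative and K = 0. The cost U^(-2 - delta) / H is
    bounded by 1 through 1 <= U^2 H.\<close>
  have block0: "norm (\<Sum>m | m < M \<and> g m = 0. of_real (v m) * a m) \<le> 2"
  proof -
    have "norm (\<Sum>m | m < M \<and> g m = 0. of_real (v m) * a m) \<le> U powr (- 1 - \<delta>) * (1 + 1 / (pi * (2 * H * U)) + 2 * 0)"
    proof (rule KL[where j = 0])
      fix m assume m: "m \<in> {m. m < M \<and> g m = 0}"
      show "v m \<le> U powr (- 1 - \<delta>)" unfolding v_def using u_ge[of m] U \<delta> by (intro powr_mono2') auto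
      have "cot (pi * \<beta> m) \<ge> cot (pi / 2)"
        using m \<beta>_pos[of m] by (intro cot_antimono) (auto simp: g_iff)
      thus "0 \<le> cot (pi * (\<beta> m - of_int 0)) + 0" by (simp add: cot_def)
      show "\<beta> m < of_int 0 + 1" using m by (auto simp: g_iff)
    next
      fix x y z assume "x \<in> {m. m < M \<and> g m = 0}" "z \<in> {m. m < M \<and> g m = 0}" "x \<le> y" "y \<le> z"
      thus "y \<in> {m. m < M \<and> g m = 0}"
        using monoD[OF mono, of x y] monoD[OF mono, of y z] by (auto simp: g_iff)
    qed (use HU \<beta>_ge in auto)
    also have "\<dots> = U powr (- 1 - \<delta>) + (U powr (- 2 - \<delta>) / H) / (2 * pi)"
    proof -
      have "U powr (- 1 - \<delta>) = U * U powr (- 2 - \<delta>)" using U powr_add[of U 1 "- 2 - \<delta>"] by simp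
      thus ?thesis using U H by (simp add: field_simps)
    qed
    also have "\<dots> \<le> 1 + 1 / (2 * pi)"
    proof (intro add_mono divide_right_mono)
      show "U powr (- 1 - \<delta>) \<le> 1" using U \<delta> powr_mono2'[of "- 1 - \<delta>" 1 U] by simp
      have "U powr (- 2 - \<delta>) \<le> U powr (- 2)" using U \<delta> by (intro powr_mono) auto
      also have "\<dots> = 1 / U\<^sup>2" using U by (simp add: powr_minus divide_inverse powr_numeral)
      also have "\<dots> \<le> H" using U by (simp add: field_simps)
      finally show "U powr (- 2 - \<delta>) / H \<le> 1" using H by simp
    qed auto
    also have "\<dots> \<le> 2" using pi_ge_two by (simp add: field_simps)
    finally show ?thesis .
  qed

  have block: "norm (\<Sum>m | m < M \<and> g m = Suc j. of_real (v m) * a m) \<le> 384 * real (Suc j) powr (- 1 - \<delta>)" for j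
  proof -
    define J where "J = real (Suc j)"
    \<comment> \<open>The block is split at distance H from J. Within that distance the terms are
      merely counted: \<open>\<beta>\<close> advances by 2 H^2 per step, so there are O(1 / H) of
      them. Outside it Kusmin-Landau costs 1 / (pi H). All three pieces thus have the same order B /
      H.\<close>
    define S where "S = {m. m < M \<and> g m = Suc j}"
    define S1 where "S1 = {m \<in> S. \<beta> m \<le> J - H}"
    define S2 where "S2 = {m \<in> S. J - H < \<beta> m \<and> \<beta> m < J + H}"
    define S3 where "S3 = {m \<in> S. J + H \<le> \<beta> m}"
    \<comment> \<open>J / (8 H) is a lower bound for u m in the block: 2 H u + H^2 >= J / 2, and H^2
      <= 1/4 <= J / 4.\<close>
    define B where "B = (J / (8 * H)) powr (- 1 - \<delta>)"
    have J1: "J \<ge> 1" by (simp add: J_def)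
    have fin: "finite S" unfolding S_def by auto
    have S_iff: "m \<in> S \<longleftrightarrow> m < M \<and> J - 1 / 2 \<le> \<beta> m \<and> \<beta> m < J + 1 / 2" for m
      by (auto simp: S_def g_iff J_def)
    have vB: "v m \<le> B" if "m \<in> S" for m
    proof -
      have "J / 2 \<le> 2 * H * u m + H\<^sup>2" using that J1 by (auto simp: S_iff \<beta>_def)
      moreover have "H\<^sup>2 \<le> 1 / 4"
        using H power_mono[of H "1/2" 2] by (simp add: power2_eq_square)
      ultimately have "J / 4 \<le> 2 * H * u m" using J1 by linarith
      hence "J / (8 * H) \<le> u m" using H by (simp add: field_simps)
      thus ?thesis unfolding v_def B_def using J1 H \<delta> by (intro powr_mono2') auto
    qed
    have B0: "0 \<le> B" by (simp add: B_def)
    have conv: "y \<in> S" if "x \<in> S" "z \<in> S" "x \<le> y" "y \<le> z" for x y z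
      using that monoD[OF mono, of x y] monoD[OF mono, of y z] by (auto simp: S_iff)
    have H1: "1 \<le> 1 / (2 * H)" "1 / pi \<le> 1 / 2" using H pi_ge_two by (auto simp: field_simps)
    have piH: "1 / (pi * H) \<le> 1 / (2 * H)" using H pi_ge_two by (simp add: field_simps)
    have cot0: "0 \<le> cot (pi * (\<beta> m - of_int (int (Suc j))))" if "m \<in> S3" for m
    proof -
      have "cot (pi * (\<beta> m - of_int (int (Suc j)))) \<ge> cot (pi / 2)"
        using that H by (intro cot_antimono) (auto simp: S3_def S_iff J_def)
      thus ?thesis by (simp add: cot_def)
    qed
    have "norm (\<Sum>m\<in>S3. of_real (v m) * a m) \<le> B * (1 + 1 / (pi * H) + 2 * 0)"
    proof (rule KL[where j = "int (Suc j)"])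
      fix x y z assume "x \<in> S3" "z \<in> S3" "x \<le> y" "y \<le> z"
      thus "y \<in> S3" using conv monoD[OF mono, of x y] by (auto simp: S3_def)
    qed (use fin vB B0 H cot0 in \<open>auto simp: S3_def J_def S_iff\<close>)
    also have "\<dots> \<le> B * (2 / H)" 
    proof (intro mult_left_mono B0)
      have "2 / H = 4 * (1 / (2 * H))" by simp
      thus "1 + 1 / (pi * H) + 2 * 0 \<le> 2 / H" using piH H1 by linarith
    qed
    finally have 3: "norm (\<Sum>m\<in>S3. of_real (v m) * a m) \<le> B * (2 / H)" .

    \<comment> \<open>Here the base integer is j = J - 1 and the increment climbs towards J, where
      the cotangent is negative. Reflection at pi bounds it below by -1 / (pi H), which supplies K;
      the distance from j is at least l = 1/2.\<close>
    have cot1: "0 \<le> cot (pi * (\<beta> m - of_int (int j))) + 1 / (pi * H)" if "m \<in> S1" for m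
    proof -
      have "cot (pi * (1 - (\<beta> m - of_int (int j)))) \<le> cot (pi * H)"
        using that H by (intro cot_antimono) (auto simp: S1_def S_iff J_def)
      also have "\<dots> \<le> 1 / (pi * H)" using H by (intro cot_le_inverse) auto
      finally show ?thesis
        using cot_pi_minus[of "pi * (\<beta> m - of_int (int j))"] by (simp add: right_diff_distrib)
    qed
    have "norm (\<Sum>m\<in>S1. of_real (v m) * a m) \<le> B * (1 + 1 / (pi * (1 / 2)) + 2 * (1 / (pi * H)))"
    proof (rule KL[where j = "int j"])
      fix x y z assume "x \<in> S1" "z \<in> S1" "x \<le> y" "y \<le> z"
      thus "y \<in> S1" using conv monoD[OF mono, of y z] by (auto simp: S1_def)
    qed (use fin vB B0 H cot1 in \<open>auto simp: S1_def J_def S_iff\<close>)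
    also have "\<dots> \<le> B * (2 / H)"
    proof (intro mult_left_mono B0)
      have "1 / (pi * (1 / 2)) \<le> 1" using pi_ge_two by simp
      moreover have "1 + x + 2 * y \<le> 4 * h" if "x \<le> 1" "y \<le> h" "1 \<le> h" for x y h :: real
        using that by linarith
      ultimately have "1 + 1 / (pi * (1 / 2)) + 2 * (1 / (pi * H)) \<le> 4 * (1 / (2 * H))"
        using piH H1(1) by blast
      thus "1 + 1 / (pi * (1 / 2)) + 2 * (1 / (pi * H)) \<le> 2 / H" by simp
    qed
    finally have 1: "norm (\<Sum>m\<in>S1. of_real (v m) * a m) \<le> B * (2 / H)" .

    have card: "real (card S2) \<le> 2 / H"
    proof -
      have "S2 = {} \<or> (\<exists>p n. S2 = (+) p ` {..n})"
      proof (rule nat_convex_set_cases)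
        fix x y z assume "x \<in> S2" "z \<in> S2" "x \<le> y" "y \<le> z"
        thus "y \<in> S2" using conv monoD[OF mono, of x y] monoD[OF mono, of y z] by (auto simp: S2_def)
      qed (use fin in \<open>auto simp: S2_def\<close>)
      thus ?thesis
      proof (elim disjE exE)
        fix p n assume eq: "S2 = (+) p ` {..n}"
        have "p \<in> S2" "p + n \<in> S2" using eq by auto
        hence "\<beta> (p + n) - \<beta> p < 2 * H" by (auto simp: S2_def)
        also have "\<beta> (p + n) - \<beta> p = 2 * H * (H * real n)"
          by (simp add: \<beta>_def u_def algebra_simps)
        finally have "real n < 1 / H" using H by (simp add: field_simps)
        moreover have "card S2 = Suc n" unfolding eq by (subst card_image) auto
        moreover have "1 \<le> 1 / H" using H by simp
        ultimately show ?thesis by simp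
      qed (use H in auto)
    qed
    have "norm (\<Sum>m\<in>S2. of_real (v m) * a m) \<le> (\<Sum>m\<in>S2. B)"
      using vB v0 by (intro sum_norm_le) (auto simp: norm_mult a_def S2_def)
    also have "\<dots> \<le> B * (2 / H)" using card B0 mult_left_mono[OF card B0] by (simp add: mult.commute)
    finally have 2: "norm (\<Sum>m\<in>S2. of_real (v m) * a m) \<le> B * (2 / H)" .

    have "S = S1 \<union> S2 \<union> S3" using H by (auto simp: S1_def S2_def S3_def)
    hence "(\<Sum>m\<in>S. of_real (v m) * a m) = (\<Sum>m\<in>S1 \<union> S2 \<union> S3. of_real (v m) * a m)" by simp
    also have "\<dots> = (\<Sum>m\<in>S1. of_real (v m) * a m) + (\<Sum>m\<in>S2. of_real (v m) * a m) + (\<Sum>m\<in>S3. of_real (v m) * a m)"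
      using fin H by (subst sum.union_disjoint; (subst sum.union_disjoint)?) (auto simp: S1_def S2_def S3_def)
    also have "norm \<dots> \<le> B * (2 / H) + B * (2 / H) + B * (2 / H)"
      by (intro norm_triangle_le add_mono 1 2 3)
    also have "\<dots> = 6 * (B / H)" by simp
    \<comment> \<open>The factor H^delta left over is at most 1, and 8^(1 + delta) <= 64; with the 6
      from the three pieces this gives 384.\<close>
    also have "B / H = J powr (- 1 - \<delta>) * (8 powr (1 + \<delta>) * H powr \<delta>)"
    proof -
      have "B = J powr (- 1 - \<delta>) * (8 * H) powr (1 + \<delta>)"
        unfolding B_def using J1 H powr_minus[of "8 * H" "1 + \<delta>"] by (simp add: powr_divide field_simps)
      also have "(8 * H) powr (1 + \<delta>) = 8 powr (1 + \<delta>) * H powr \<delta> * H"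
        using H by (simp add: powr_mult powr_add)
      finally show ?thesis using H by simp
    qed
    also have "6 * \<dots> \<le> 6 * (J powr (- 1 - \<delta>) * (8 powr 2 * 1))"
      using H \<delta> by (intro mult_left_mono mult_mono powr_mono powr_le1) auto
    finally show ?thesis by (simp add: S_def J_def powr_numeral mult.commute)
  qed

  have "(\<Sum>m<M. of_real (v m) * a m) = (\<Sum>j\<le>g M. \<Sum>m | m < M \<and> g m = j. of_real (v m) * a m)"
  proof -
    have "g ` {..<M} \<subseteq> {..g M}"
      using monoD[OF mono] by (auto simp: g_def intro!: nat_mono floor_mono)
    from sum.group[OF _ _ this, of "\<lambda>m. of_real (v m) * a m"] show ?thesis by simp
  qed
  also have "\<dots> = (\<Sum>m | m < M \<and> g m = 0. of_real (v m) * a m)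
      + (\<Sum>j<g M. \<Sum>m | m < M \<and> g m = Suc j. of_real (v m) * a m)"
    by (subst sum.atMost_shift) simp
  also have "norm \<dots> \<le> 2 + (\<Sum>j<g M. 384 * real (Suc j) powr (- 1 - \<delta>))"
    by (intro norm_triangle_le add_mono block0 sum_norm_le block)
  also have "\<dots> \<le> 2 + 384 * zsum \<delta>"
    using sum_le_zsum[OF \<delta>(1)] by (simp flip: sum_distrib_left)
  finally show ?thesis by (simp add: v_def a_def u_def)
qed

section \<open>Riemann sums of the kernel\<close>

text \<open>The majorant telescopes through its primitive. Omitting the point s lets every term be
  compared with the cell to its left. The bound is uniform in H, which serves large steps as well as
  summability.\<close>

lemma kern_partial_sum_bound:
  assumes "0 < \<delta>" "\<delta> \<le> 1" "0 < H" "0 \<le> s"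
  shows "H * (\<Sum>m<M. norm (kern \<delta> (s + real (Suc m) * H))) \<le> 8 * pi / \<delta>"
proof -
  define g where "g m = (1 + s + real m * H) powr (- \<delta>) / \<delta>" for m
  have "H * norm (kern \<delta> (s + real (Suc m) * H)) \<le> 8 * pi * (g m - g (Suc m))" for m
  proof -
    have pos: "0 < 1 + s + real m * H" "0 \<le> s + real (Suc m) * H" using assms by (auto intro!: add_pos_nonneg add_nonneg_nonneg)
    have "H * norm (kern \<delta> (s + real (Suc m) * H)) \<le> H * (8 * pi * (1 + (s + real (Suc m) * H)) powr (- 1 - \<delta>))"
      using assms norm_kern_le[OF assms(1,2) pos(2)] by (intro mult_left_mono) auto
    also have "\<dots> = 8 * pi * (H * ((1 + s + real m * H) + H) powr (- 1 - \<delta>))"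
      by (simp add: algebra_simps)
    also have "\<dots> \<le> 8 * pi * (g m - g (Suc m))"
      using powr_step_bounds(1)[OF pos(1) assms(3,1)]
      by (intro mult_left_mono) (auto simp: g_def diff_divide_distrib algebra_simps)
    finally show ?thesis .
  qed
  hence "H * (\<Sum>m<M. norm (kern \<delta> (s + real (Suc m) * H))) \<le> (\<Sum>m<M. 8 * pi * (g m - g (Suc m)))"
    unfolding sum_distrib_left by (intro sum_mono) auto
  also have "\<dots> = 8 * pi * (g 0 - g M)"
    by (simp add: sum_lessThan_telescope' flip: sum_distrib_left)
  also have "\<dots> \<le> 8 * pi * (1 / \<delta>)"
  proof (intro mult_left_mono)
    have "(1 + s) powr (- \<delta>) \<le> 1" using assms powr_mono2'[of "- \<delta>" 1 "1 + s"] by simp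
    hence "g 0 \<le> 1 / \<delta>" using assms by (simp add: g_def divide_right_mono)
    moreover have "g M \<ge> 0" using assms by (simp add: g_def)
    ultimately show "g 0 - g M \<le> 1 / \<delta>" by simp
  qed auto
  finally show ?thesis by simp
qed

lemma kern_summable_norm:
  assumes "0 < \<delta>" "\<delta> \<le> 1" "0 < H" "0 \<le> s"
  shows "summable (\<lambda>m. norm (kern \<delta> (s + real m * H)))"
proof -
  have "summable (\<lambda>m. norm (kern \<delta> (s + real (Suc m) * H)))"
  proof (rule bounded_imp_summable)
    fix n
    show "(\<Sum>m\<le>n. norm (kern \<delta> (s + real (Suc m) * H))) \<le> 8 * pi / \<delta> / H"
      using kern_partial_sum_bound[OF assms, of "Suc n"]
      by (subst pos_le_divide_eq[OF assms(3)], subst mult.commute) (simp only: lessThan_Suc_atMost)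
  qed auto
  thus ?thesis by (subst (asm) summable_Suc_iff)
qed

lemmas kern_summable = summable_norm_cancel[OF kern_summable_norm]

text \<open>The offset s may be arbitrarily small, so f'' has no usable bound on the first cell: the
  point s and the integral up to s + H are estimated trivially, as the kernel is bounded. The
  trapezoidal rule covers the other cells. The trivial estimates give 8 pi + 16 pi, the two half end
  terms 8 pi.\<close>

lemma kern_riemann_sum_head:
  fixes \<delta> H s :: real and n :: nat
  defines "U \<equiv> s + real (Suc n) * H"
  assumes \<delta>: "0 < \<delta>" "\<delta> \<le> 1" and H: "0 < H" "H \<le> 1" and s: "0 < s" "s \<le> H"
    and U: "1 \<le> U" "U\<^sup>2 * H \<le> 4"
  shows "norm (of_real H * (\<Sum>m<Suc n. kern \<delta> (s + real m * H)) - kern_primitive \<delta> U)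
      \<le> (32 * pi + 300 * zsum \<delta> + 1200) * H"
proof -
  define u where "u m = s + real m * H" for m
  define x where "x k = kern \<delta> (u (Suc k))" for k
  define P where "P k = kern_primitive \<delta> (u (Suc k))" for k
  define T where "T k = P (Suc k) - P k - (H / 2) *\<^sub>R (x k + x (Suc k))" for k
  have u_pos: "u m > 0" for m using H s by (simp add: u_def add_pos_nonneg)
  have u_Suc: "u (Suc m) = u m + H" for m by (simp add: u_def algebra_simps)
  have kern_le: "norm (kern \<delta> (u m)) \<le> 8 * pi" for m
    using norm_kern_le_const[OF \<delta>] u_pos[of m] by simp

  have T_le: "norm (T k) \<le> 300 * (H\<^sup>2 * H powr (- \<delta>) * real (Suc k) powr (- 1 - \<delta>)) + 300 * (U powr (1 - \<delta>) * H ^ 3)"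
    if k: "k < n" for k
  proof -
    have uU: "u (Suc (Suc k)) \<le> U"
      using k H unfolding U_def u_def by (intro add_left_mono mult_right_mono) auto
    have lo: "real (Suc k) * H \<le> u (Suc k)" using s by (simp add: u_def)
    have "norm (kern_primitive \<delta> (u (Suc (Suc k))) - kern_primitive \<delta> (u (Suc k))
        - ((u (Suc (Suc k)) - u (Suc k)) / 2) *\<^sub>R (kern \<delta> (u (Suc k)) + kern \<delta> (u (Suc (Suc k)))))
        \<le> (300 * ((real (Suc k) * H) powr (- 1 - \<delta>) + U powr (1 - \<delta>))) * (u (Suc (Suc k)) - u (Suc k)) ^ 3"
    proof (rule trapezoid_error)
      fix y assume y: "y \<in> {u (Suc k)..u (Suc (Suc k))}"
      have y0: "y > 0" using y u_pos[of "Suc k"] by auto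
      show "(kern_primitive \<delta> has_vector_derivative kern \<delta> y) (at y)"
        by (rule kern_primitive_has_vector_derivative[OF \<delta> y0])
      show "(kern \<delta> has_vector_derivative kern' \<delta> y) (at y)"
        by (rule kern_has_vector_derivative[OF y0])
      show "(kern' \<delta> has_vector_derivative kern'' \<delta> y) (at y)"
        by (rule kern'_has_vector_derivative[OF y0])
      have "norm (kern'' \<delta> y) \<le> 300 * (y powr (- 1 - \<delta>) + y powr (1 - \<delta>))"
        by (rule norm_kern''_le[OF \<delta> y0])
      also have "\<dots> \<le> 300 * ((real (Suc k) * H) powr (- 1 - \<delta>) + U powr (1 - \<delta>))"
        using y y0 lo uU \<delta> H by (intro mult_left_mono add_mono powr_mono2' powr_mono2) auto
      finally show "norm (kern'' \<delta> y) \<le> 300 * ((real (Suc k) * H) powr (- 1 - \<delta>) + U powr (1 - \<delta>))" .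
    qed (use H in \<open>auto simp: u_Suc\<close>)
    also have "u (Suc (Suc k)) - u (Suc k) = H" by (simp add: u_Suc)
    also have "(300 * ((real (Suc k) * H) powr (- 1 - \<delta>) + U powr (1 - \<delta>))) * H ^ 3 =
        300 * (real (Suc k) powr (- 1 - \<delta>) * (H powr (- 1 - \<delta>) * H ^ 3)) + 300 * (U powr (1 - \<delta>) * H ^ 3)"
      using H by (subst powr_mult) (auto simp: algebra_simps)
    also have "H powr (- 1 - \<delta>) * H ^ 3 = H\<^sup>2 * H powr (- \<delta>)"
      using H by (simp add: powr_add[symmetric] flip: powr_numeral)
    finally show ?thesis by (simp add: T_def P_def x_def mult_ac)
  qed

  have "norm (\<Sum>k<n. T k) \<le> (\<Sum>k<n. 300 * (H\<^sup>2 * H powr (- \<delta>) * real (Suc k) powr (- 1 - \<delta>)) + 300 * (U powr (1 - \<delta>) * H ^ 3))"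
    by (intro sum_norm_le T_le) auto
  also have "\<dots> = 300 * (H\<^sup>2 * H powr (- \<delta>) * (\<Sum>k<n. real (Suc k) powr (- 1 - \<delta>))) + 300 * (U powr (1 - \<delta>) * (real n * H) * H\<^sup>2)"
    by (simp add: sum.distrib flip: sum_distrib_left) (simp add: power2_eq_square power3_eq_cube)
  \<comment> \<open>The singular part uses H^(2 - delta) <= H. For the growing part n H <= U and U^2
    H <= 4: this is where the upper bound on the cut enters.\<close>
  also have "\<dots> \<le> 300 * (H * zsum \<delta>) + 300 * (4 * H)"
  proof (rule add_mono; rule mult_left_mono)
    have "H\<^sup>2 * H powr (- \<delta>) = H powr (2 - \<delta>)"
      using H by (simp add: powr_add[symmetric] flip: powr_numeral)
    also have "\<dots> \<le> H powr 1" using H \<delta> by (intro powr_mono') auto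
    finally have "H\<^sup>2 * H powr (- \<delta>) \<le> H" using H by simp
    thus "H\<^sup>2 * H powr (- \<delta>) * (\<Sum>k<n. real (Suc k) powr (- 1 - \<delta>)) \<le> H * zsum \<delta>"
      using H by (intro mult_mono sum_le_zsum \<delta> sum_nonneg) auto
    have "U powr (1 - \<delta>) * (real n * H) * H\<^sup>2 \<le> U powr 1 * U * H\<^sup>2"
      using U H s \<delta> by (intro mult_right_mono mult_mono powr_mono) (auto simp: U_def algebra_simps)
    also have "\<dots> = U\<^sup>2 * H * H" using U by (simp add: power2_eq_square)
    also have "\<dots> \<le> 4 * H" using U H by (intro mult_right_mono) auto
    finally show "U powr (1 - \<delta>) * (real n * H) * H\<^sup>2 \<le> 4 * H" .
  qed auto
  finally have sum_T: "norm (\<Sum>k<n. T k) \<le> 300 * (H * zsum \<delta>) + 300 * (4 * H)" .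

  have tele: "(\<Sum>k<n. T k) = P n - P 0 - of_real H * (\<Sum>k<n. x k) - of_real (H / 2) * (x n - x 0)"
  proof (induction n)
    case (Suc n)
    have "of_real H = 2 * (of_real (H / 2) :: complex)" by simp
    thus ?case unfolding sum.lessThan_Suc Suc by (simp only: T_def scaleR_conv_of_real) (simp only: algebra_simps, simp)
  qed simp
  have "of_real H * (\<Sum>m<Suc n. kern \<delta> (u m)) - kern_primitive \<delta> U
      = of_real H * kern \<delta> (u 0) - P 0 - (\<Sum>k<n. T k) - of_real (H / 2) * (x n - x 0)"
    unfolding tele by (subst sum.lessThan_Suc_shift) (simp add: x_def P_def U_def u_def algebra_simps)
  also have "norm \<dots> \<le> H * (8 * pi) + 8 * pi * (2 * H) + (300 * (H * zsum \<delta>) + 300 * (4 * H)) + H / 2 * (8 * pi + 8 * pi)"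
  proof (intro norm_triangle_le_diff add_mono sum_T)
    show "norm (of_real H * kern \<delta> (u 0)) \<le> H * (8 * pi)"
      using kern_le[of 0] H by (simp add: norm_mult)
    have "norm (P 0) \<le> 8 * pi * u 1" unfolding P_def using norm_kern_primitive_le[OF \<delta>, of "u 1"] u_pos[of 1] by simp
    also have "\<dots> \<le> 8 * pi * (2 * H)" using s by (simp add: u_def)
    finally show "norm (P 0) \<le> 8 * pi * (2 * H)" .
    have "norm (x n - x 0) \<le> 8 * pi + 8 * pi"
      unfolding x_def by (intro norm_triangle_le_diff add_mono kern_le)
    thus "norm (of_real (H / 2) * (x n - x 0)) \<le> H / 2 * (8 * pi + 8 * pi)"
      unfolding norm_mult using H by (intro mult_mono) auto
  qed
  also have "\<dots> = (32 * pi + 300 * zsum \<delta> + 1200) * H" by (simp add: field_simps)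
  finally show ?thesis by (simp add: u_def)
qed

text \<open>Each term's error lies between 0 and H times the drop of the weight across its cell, so
  the accumulated error never exceeds H times the first weight.\<close>

lemma powr_riemann_sum:
  fixes H U \<delta> :: real
  assumes "0 < H" "0 < U" "0 < \<delta>"
  shows "\<bar>H * (\<Sum>m<M. (U + real m * H) powr (- 1 - \<delta>)) - (U powr (- \<delta>) - (U + real M * H) powr (- \<delta>)) / \<delta>\<bar>
     \<le> H * U powr (- 1 - \<delta>)"
proof -
  define D where "D M = H * (\<Sum>m<M. (U + real m * H) powr (- 1 - \<delta>)) - (U powr (- \<delta>) - (U + real M * H) powr (- \<delta>)) / \<delta>" for M
  have "0 \<le> D M \<and> D M \<le> H * (U powr (- 1 - \<delta>) - (U + real M * H) powr (- 1 - \<delta>))"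
  proof (induction M)
    case (Suc M)
    have pos: "0 < U + real M * H" using assms by (simp add: add_pos_nonneg)
    have "D (Suc M) = D M + (H * (U + real M * H) powr (- 1 - \<delta>)
        - ((U + real M * H) powr (- \<delta>) - (U + real M * H + H) powr (- \<delta>)) / \<delta>)"
      by (simp add: D_def algebra_simps diff_divide_distrib)
    moreover have eq: "U + real (Suc M) * H = U + real M * H + H" by (simp add: algebra_simps)
    ultimately show ?case
      using Suc.IH powr_step_bounds[OF pos assms(1,3)] unfolding eq right_diff_distrib by linarith
  qed (simp add: D_def)
  moreover have "0 \<le> H * (U + real M * H) powr (- 1 - \<delta>)" using assms by simp
  ultimately show ?thesis unfolding D_def right_diff_distrib by linarith
qed

text \<open>For partial sums the kernel is separated into its monotone part, with error at most H,
  and its oscillating part, at most H (2 + 384 zeta(1 + delta)). Both bounds are uniform in M, and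
  the end term (U + M H)^(-delta) vanishes in the limit.\<close>

lemma kern_riemann_sum_tail:
  assumes \<delta>: "0 < \<delta>" "\<delta> \<le> 1" and H: "0 < H" "H \<le> 1 / 2" and U: "1 \<le> U" "1 \<le> U\<^sup>2 * H"
  shows "norm (of_real H * (\<Sum>m. kern \<delta> (U + real m * H)) - of_real (U powr (- \<delta>) / \<delta>)) \<le> (3 + 384 * zsum \<delta>) * H"
proof -
  have pos: "0 < U + real m * H" for m using U H by (simp add: add_pos_nonneg)
  have part: "norm (of_real H * (\<Sum>m<M. kern \<delta> (U + real m * H)) - of_real ((U powr (- \<delta>) - (U + real M * H) powr (- \<delta>)) / \<delta>))
      \<le> (3 + 384 * zsum \<delta>) * H" for M
  proof -
    let ?w = "\<lambda>m. (U + real m * H) powr (- 1 - \<delta>)"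
    have "of_real H * (\<Sum>m<M. kern \<delta> (U + real m * H)) - of_real ((U powr (- \<delta>) - (U + real M * H) powr (- \<delta>)) / \<delta>)
       = of_real (H * (\<Sum>m<M. ?w m) - (U powr (- \<delta>) - (U + real M * H) powr (- \<delta>)) / \<delta>)
        - of_real H * (\<Sum>m<M. of_real (?w m) * e ((U + real m * H)\<^sup>2))"
      by (simp add: kern_eq algebra_simps sum_subtractf)
    also have "norm \<dots> \<le> H * U powr (- 1 - \<delta>) + H * (2 + 384 * zsum \<delta>)"
    proof (intro norm_triangle_le_diff add_mono)
      show "norm (of_real (H * (\<Sum>m<M. ?w m) - (U powr (- \<delta>) - (U + real M * H) powr (- \<delta>)) / \<delta>) :: complex) \<le> H * U powr (- 1 - \<delta>)"
        unfolding norm_of_real by (rule powr_riemann_sum) (use assms in auto)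
      show "norm (of_real H * (\<Sum>m<M. of_real (?w m) * e ((U + real m * H)\<^sup>2))) \<le> H * (2 + 384 * zsum \<delta>)"
        unfolding norm_mult using oscillating_sum_bound[OF assms, of M] H by (intro mult_mono) auto
    qed
    also have "U powr (- 1 - \<delta>) \<le> 1" using U \<delta> powr_mono2'[of "- 1 - \<delta>" 1 U] by simp
    finally show ?thesis using H by (simp add: algebra_simps)
  qed
  have sums: "(\<lambda>m. kern \<delta> (U + real m * H)) sums (\<Sum>m. kern \<delta> (U + real m * H))"
    by (rule summable_sums, rule kern_summable[OF \<delta> H(1)]) (use U in auto)
  have "filterlim (\<lambda>M. U + real M * H) at_top sequentially"
    by (rule filterlim_tendsto_add_at_top[OF tendsto_const
          filterlim_at_top_mult_tendsto_pos[OF tendsto_const H(1) filterlim_real_sequentially]])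
  hence "(\<lambda>M. (U + real M * H) powr (- \<delta>)) \<longlonglongrightarrow> 0"
    by (rule tendsto_neg_powr[rotated]) (use \<delta> in auto)
  hence "(\<lambda>M. norm (of_real H * (\<Sum>m<M. kern \<delta> (U + real m * H)) - of_real ((U powr (- \<delta>) - (U + real M * H) powr (- \<delta>)) / \<delta>)))
      \<longlonglongrightarrow> norm (of_real H * (\<Sum>m. kern \<delta> (U + real m * H)) - of_real ((U powr (- \<delta>) - 0) / \<delta>))"
    by (intro tendsto_intros sums[unfolded sums_def]) (use \<delta> in auto)
  from LIMSEQ_le_const2[OF this] part show ?thesis by auto
qed

lemma kern_riemann_sum:
  assumes \<delta>: "0 < \<delta>" "\<delta> \<le> 1" and H: "0 < H" "H \<le> 1 / 2" and s: "0 < s" "s \<le> H"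
  shows "norm (of_real H * (\<Sum>m. kern \<delta> (s + real m * H)) - kern_integral \<delta>) \<le> (32 * pi + 684 * zsum \<delta> + 1204) * H"
proof -
  \<comment> \<open>U is the first grid point s + N H that is at least V. As H <= V, it is at most 2
    V, so V^2 H = 1 yields 1 <= U^2 H <= 4 as head and tail require.\<close>
  define V where "V = 1 / sqrt H"
  define N where "N = nat \<lceil>(V - s) / H\<rceil>"
  define U where "U = s + real N * H"
  have V2: "V\<^sup>2 * H = 1" using H by (simp add: V_def power_divide)
  have V1: "1 \<le> V" using H by (simp add: V_def)
  have Vs: "0 < (V - s) / H" using V1 H s by simp
  have N: "(V - s) / H \<le> real N" "real N < (V - s) / H + 1"
    using Vs by (auto simp: N_def) linarith
  have N0: "N > 0" using N(1) Vs by (cases N) auto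
  then obtain n where n: "N = Suc n" by (cases N) auto
  have UV: "V \<le> U" "U \<le> 2 * V"
    using N H V1 by (auto simp: U_def field_simps)
  have U1: "1 \<le> U" using UV V1 by simp
  have U2: "1 \<le> U\<^sup>2 * H" "U\<^sup>2 * H \<le> 4"
  proof -
    have "V\<^sup>2 * H \<le> U\<^sup>2 * H" using UV V1 H by (intro mult_right_mono power_mono) auto
    thus "1 \<le> U\<^sup>2 * H" using V2 by simp
    have "U\<^sup>2 * H \<le> (2 * V)\<^sup>2 * H" using UV U1 H by (intro mult_right_mono power_mono) auto
    thus "U\<^sup>2 * H \<le> 4" using V2 by (simp add: power_mult_distrib)
  qed
  have head: "norm (of_real H * (\<Sum>m<Suc n. kern \<delta> (s + real m * H)) - kern_primitive \<delta> U)
      \<le> (32 * pi + 300 * zsum \<delta> + 1200) * H"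
    using kern_riemann_sum_head[OF \<delta> H(1) _ s, of n] H U1 U2 by (simp add: U_def n)
  note tail = kern_riemann_sum_tail[OF \<delta> H U1 U2(1)]
  have int: "norm (kern_integral \<delta> - kern_primitive \<delta> U - of_real (U powr (- \<delta>) / \<delta>)) \<le> H"
  proof -
    have "U powr (- 2 - \<delta>) \<le> U powr (- 2)" using U1 \<delta> by (intro powr_mono) auto
    also have "\<dots> = 1 / U\<^sup>2" using U1 by (simp add: powr_minus divide_inverse powr_numeral)
    also have "\<dots> \<le> H" using U1 U2 by (simp add: field_simps)
    finally show ?thesis using kern_integral_tail[OF \<delta>, of U] U1 by simp
  qed
  have "summable (\<lambda>m. kern \<delta> (s + real m * H))"
    by (rule kern_summable[OF \<delta> H(1)]) (use s in auto)
  from suminf_split_initial_segment[OF this, of N]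
  have split: "(\<Sum>m. kern \<delta> (s + real m * H)) = (\<Sum>m. kern \<delta> (U + real m * H)) + (\<Sum>m<Suc n. kern \<delta> (s + real m * H))"
    by (simp add: U_def n algebra_simps)
  have "of_real H * (\<Sum>m. kern \<delta> (s + real m * H)) - kern_integral \<delta> =
     (of_real H * (\<Sum>m<Suc n. kern \<delta> (s + real m * H)) - kern_primitive \<delta> U)
     + (of_real H * (\<Sum>m. kern \<delta> (U + real m * H)) - of_real (U powr (- \<delta>) / \<delta>))
     - (kern_integral \<delta> - kern_primitive \<delta> U - of_real (U powr (- \<delta>) / \<delta>))"
    unfolding split by (simp only: distrib_left) simp
  also have "norm \<dots> \<le> (32 * pi + 300 * zsum \<delta> + 1200) * H + (3 + 384 * zsum \<delta>) * H + H"
    by (intro norm_triangle_le_diff norm_triangle_le add_mono head tail int)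
  also have "\<dots> = (32 * pi + 684 * zsum \<delta> + 1204) * H" by (simp add: algebra_simps)
  finally show ?thesis .
qed

section \<open>Twisted sums\<close>

definition coef :: "int \<Rightarrow> int \<Rightarrow> nat \<Rightarrow> nat \<Rightarrow> complex" where
  "coef k a0 q n = e (real_of_int (k * a0) * real n ^ 2 / real q)"

lemma norm_coef [simp]: "norm (coef k a0 q n) = 1"
  by (simp add: coef_def)

lemma coef_periodic:
  assumes "q \<ge> 1"
  shows "coef k a0 q (n + m * q) = coef k a0 q n"
proof -
  have "real_of_int (k * a0) * real (n + m * q) ^ 2 / real q =
      real_of_int (k * a0) * real n ^ 2 / real q + of_int (k * a0 * (2 * int n * int m + int m ^ 2 * int q))"
    using assms by (simp add: field_simps power2_eq_square)
  thus ?thesis unfolding coef_def by (simp only: e_add e_int mult_1_right)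
qed

lemma gauss_mean_eq: "gauss_mean (k * a0) q = (\<Sum>r<q. coef k a0 q (Suc r)) / of_nat q"
proof -
  have "(\<Sum>n=1..q. coef k a0 q n) = (\<Sum>r<q. coef k a0 q (Suc r))"
    by (rule sum.reindex_bij_witness[of _ Suc "\<lambda>n. n - 1"]) auto
  thus ?thesis by (simp add: gauss_mean_def coef_def)
qed

lemma norm_gauss_mean_le: "norm (gauss_mean (k * a0) q) \<le> 1"
proof -
  have "norm (\<Sum>r<q. coef k a0 q (Suc r)) \<le> (\<Sum>r<q. 1)" by (intro sum_norm_le) auto
  thus ?thesis by (cases "q = 0") (auto simp: gauss_mean_eq norm_divide)
qed

text \<open>For k > 0 and h = sqrt k / p, multiplication by h^(1 + delta) turns this into
  T_k(p).\<close>

definition twisted_sum :: "real \<Rightarrow> int \<Rightarrow> int \<Rightarrow> nat \<Rightarrow> real \<Rightarrow> complex" where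
  "twisted_sum \<delta> k a0 q h = (\<Sum>n. coef k a0 q (Suc n) * kern \<delta> (real (Suc n) * h))"

lemma twisted_summable_norm:
  assumes "0 < \<delta>" "\<delta> \<le> 1" "0 < h"
  shows "summable (\<lambda>n. norm (coef k a0 q (Suc n) * kern \<delta> (real (Suc n) * h)))"
  using kern_summable_norm[OF assms, of h] assms by (simp add: norm_mult algebra_simps)

lemmas twisted_summable = summable_norm_cancel[OF twisted_summable_norm]

lemma norm_twisted_sum_le:
  assumes "0 < \<delta>" "\<delta> \<le> 1" "0 < h"
  shows "norm (of_real h * twisted_sum \<delta> k a0 q h) \<le> 8 * pi / \<delta>"
proof -
  let ?f = "\<lambda>n. norm (coef k a0 q (Suc n) * kern \<delta> (real (Suc n) * h))"
  have "norm (twisted_sum \<delta> k a0 q h) \<le> (\<Sum>n. ?f n)"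
    unfolding twisted_sum_def by (rule summable_norm[OF twisted_summable_norm[OF assms]])
  also have "\<dots> \<le> 8 * pi / \<delta> / h"
  proof (rule suminf_le_const[OF twisted_summable_norm[OF assms]])
    fix n
    show "sum ?f {..<n} \<le> 8 * pi / \<delta> / h"
      using kern_partial_sum_bound[OF assms, of 0 n]
      by (subst pos_le_divide_eq[OF assms(3)], subst mult.commute) (simp add: norm_mult del: of_nat_Suc)
  qed
  finally show ?thesis using assms by (simp add: norm_mult field_simps)
qed

text \<open>Absolute convergence allows the regrouping, and \<open>coef\<close> is constant on
  residue classes. The representatives are 1..q and not 0..q-1, which puts the offsets (r + 1) h
  into the interval from 0 (excluded) to q h (included).\<close>

lemma twisted_sum_residues:
  assumes "0 < \<delta>" "\<delta> \<le> 1" "0 < h" "q \<ge> 1"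
  shows "twisted_sum \<delta> k a0 q h =
    (\<Sum>r<q. coef k a0 q (Suc r) * (\<Sum>m. kern \<delta> (real (Suc r) * h + real m * (real q * h))))"
proof -
  let ?f = "\<lambda>n. coef k a0 q (Suc n) * kern \<delta> (real (Suc n) * h)"
  let ?g = "\<lambda>r m. kern \<delta> (real (Suc r) * h + real m * (real q * h))"
  have summ: "summable (?g r)" for r
    using assms by (intro kern_summable) auto
  have "?f sums twisted_sum \<delta> k a0 q h"
    unfolding twisted_sum_def by (intro summable_sums twisted_summable assms)
  hence "(\<lambda>m. sum ?f {m * q..<m * q + q}) sums twisted_sum \<delta> k a0 q h"
    by (rule sums_group) (use assms in auto)
  moreover have "sum ?f {m * q..<m * q + q} = (\<Sum>r<q. coef k a0 q (Suc r) * ?g r m)" for m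
  proof -
    have "sum ?f {m * q..<m * q + q} = (\<Sum>r<q. ?f (r + m * q))"
      using sum.shift_bounds_nat_ivl[of ?f 0 "m * q" q] by (simp add: atLeast0LessThan add.commute)
    also have "\<dots> = (\<Sum>r<q. coef k a0 q (Suc r) * ?g r m)"
    proof (intro sum.cong refl)
      fix r
      show "?f (r + m * q) = coef k a0 q (Suc r) * ?g r m"
        using coef_periodic[OF assms(4), of k a0 "Suc r" m] by (simp add: algebra_simps)
    qed
    finally show ?thesis .
  qed
  ultimately have "(\<lambda>m. \<Sum>r<q. coef k a0 q (Suc r) * ?g r m) sums twisted_sum \<delta> k a0 q h" by simp
  moreover have "(\<lambda>m. \<Sum>r<q. coef k a0 q (Suc r) * ?g r m) sums (\<Sum>r<q. coef k a0 q (Suc r) * suminf (?g r))"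
    by (intro sums_sum sums_mult summable_sums summ)
  ultimately show ?thesis by (rule sums_unique2)
qed

text \<open>Writing h = (q h) / q exhibits the left side as the mean over r of unimodular
  coefficients times Riemann sum errors with step q h; the integral picks up the mean of the
  coefficients, which is the Gauss mean. Averaging keeps the bound for a single error.\<close>

lemma twisted_sum_error_small:
  assumes "0 < \<delta>" "\<delta> \<le> 1" "0 < h" "q \<ge> 1" "real q * h \<le> 1 / 2"
  shows "norm (of_real h * twisted_sum \<delta> k a0 q h - gauss_mean (k * a0) q * kern_integral \<delta>)
      \<le> (32 * pi + 684 * zsum \<delta> + 1204) * (real q * h)"
proof -
  let ?g = "\<lambda>r. \<Sum>m. kern \<delta> (real (Suc r) * h + real m * (real q * h))"
  let ?B = "(32 * pi + 684 * zsum \<delta> + 1204) * (real q * h)"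
  let ?S = "\<Sum>r<q. coef k a0 q (Suc r) * (of_real (real q * h) * ?g r - kern_integral \<delta>)"
  have eq: "of_real h * twisted_sum \<delta> k a0 q h - gauss_mean (k * a0) q * kern_integral \<delta>
     = ?S / of_nat q"
  proof -
    have "(\<Sum>r<q. c r * (x * y r - z)) = x * (\<Sum>r<q. c r * y r) - (\<Sum>r<q. c r) * z"
      for c y :: "nat \<Rightarrow> complex" and x z
      by (simp add: right_diff_distrib sum_subtractf sum_distrib_left sum_distrib_right mult.left_commute)
    note this[of "coef k a0 q \<circ> Suc", unfolded o_def]
    thus ?thesis
      using assms(4) unfolding twisted_sum_residues[OF assms(1-4)] gauss_mean_eq
      by (simp add: diff_divide_distrib)
  qed
  have "norm ?S \<le> (\<Sum>r<q. ?B)"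
  proof (rule sum_norm_le)
    fix r assume r: "r \<in> {..<q}"
    have r1: "real (Suc r) * h \<le> real q * h"
      using r assms(3) by (intro mult_right_mono) auto
    have "norm (of_real (real q * h) * ?g r - kern_integral \<delta>) \<le> ?B"
      by (rule kern_riemann_sum[OF assms(1,2) _ assms(5) _ r1]) (use assms(3,4) in auto)
    thus "norm (coef k a0 q (Suc r) * (of_real (real q * h) * ?g r - kern_integral \<delta>)) \<le> ?B"
      by (simp add: norm_mult)
  qed
  thus ?thesis using assms(4) unfolding eq norm_divide by (simp add: field_simps)
qed

text \<open>The exponent alpha enters here. If q h <= 1/2 then h <= 1 and h <= h^alpha. Otherwise q
  h^alpha >= 1/2, and the trivial bounds 8 pi / delta for sum and integral add up to half of 32 pi /
  delta.\<close>

lemma twisted_sum_error: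
  assumes \<delta>: "0 < \<delta>" "\<delta> \<le> 1" and h: "0 < h" and q: "q \<ge> 1" and \<alpha>: "0 < \<alpha>" "\<alpha> \<le> 1"
  shows "norm (of_real h * twisted_sum \<delta> k a0 q h - gauss_mean (k * a0) q * kern_integral \<delta>)
      \<le> (32 * pi + 684 * zsum \<delta> + 1204 + 32 * pi / \<delta>) * (real q * h powr \<alpha>)"
proof (cases "real q * h \<le> 1 / 2")
  case True
  have "1 * h \<le> real q * h" using q h by (intro mult_right_mono) auto
  hence "h \<le> 1" using True by simp
  hence "h powr 1 \<le> h powr \<alpha>" using \<alpha> h by (intro powr_mono') auto
  hence "(32 * pi + 684 * zsum \<delta> + 1204) * (real q * h) \<le> (32 * pi + 684 * zsum \<delta> + 1204 + 32 * pi / \<delta>) * (real q * h powr \<alpha>)"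
    using h \<delta> zsum_nonneg[OF \<delta>(1)] by (intro mult_mono mult_left_mono) auto
  thus ?thesis using twisted_sum_error_small[OF \<delta> h q True, of k a0] by linarith
next
  case False
  have half: "1 / 2 \<le> real q * h powr \<alpha>"
  proof (cases "h \<le> 1")
    case True
    hence "h powr 1 \<le> h powr \<alpha>" using \<alpha> h by (intro powr_mono') auto
    hence "real q * h \<le> real q * h powr \<alpha>" using h by (intro mult_left_mono) auto
    thus ?thesis using False by linarith
  next
    case False
    hence "1 * 1 \<le> real q * h powr \<alpha>" using q \<alpha> by (intro mult_mono ge_one_powr_ge_zero) auto
    thus ?thesis by simp
  qed
  have "norm (of_real h * twisted_sum \<delta> k a0 q h - gauss_mean (k * a0) q * kern_integral \<delta>)
     \<le> 8 * pi / \<delta> + 1 * (8 * pi / \<delta>)"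
  proof (intro norm_triangle_le_diff add_mono norm_twisted_sum_le \<delta> h)
    show "norm (gauss_mean (k * a0) q * kern_integral \<delta>) \<le> 1 * (8 * pi / \<delta>)"
      unfolding norm_mult by (intro mult_mono norm_gauss_mean_le norm_kern_integral_le \<delta>) auto
  qed
  also have "\<dots> = (32 * pi / \<delta>) * (1 / 2)" by simp
  also have "\<dots> \<le> (32 * pi + 684 * zsum \<delta> + 1204 + 32 * pi / \<delta>) * (real q * h powr \<alpha>)"
    using half \<delta> zsum_nonneg[OF \<delta>(1)] by (intro mult_mono) auto
  finally show ?thesis .
qed

section \<open>Scaling back to the series, the integral and the error term\<close>

lemma sqrt_powr: "0 \<le> x \<Longrightarrow> sqrt x powr y = x powr (y / 2)"
  by (simp add: powr_half_sqrt[symmetric] powr_powr)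

lemma M_int_eq:
  assumes "k > 0"
  shows "M_int \<delta> k = of_real (real_of_int k powr (\<delta> / 2)) * kern_integral \<delta>"
proof -
  define c where "c = sqrt (real_of_int k)"
  have c: "c > 0" "c\<^sup>2 = real_of_int k" using assms by (auto simp: c_def)
  have ck: "c powr x = real_of_int k powr (x / 2)" for x
    using assms by (simp add: c_def sqrt_powr)
  have "kern_integral \<delta> = (LBINT x. indicator {0..} x *\<^sub>R kern \<delta> x)"
    by (simp add: kern_integral_def set_lebesgue_integral_def)
  also have "\<dots> = \<bar>c\<bar> *\<^sub>R (LBINT x. indicator {0..} (0 + c * x) *\<^sub>R kern \<delta> (0 + c * x))"
    by (rule lborel_integral_real_affine) (use c in auto)
  also have "(\<lambda>x. indicator {0..} (0 + c * x) *\<^sub>R kern \<delta> (0 + c * x)) =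
     (\<lambda>x. of_real (c powr (- 1 - \<delta>)) * (indicator {0<..} x *\<^sub>R ((1 - e (real_of_int k * x ^ 2)) / of_real (x powr (1 + \<delta>)))))"
  proof
    fix x
    show "indicator {0..} (0 + c * x) *\<^sub>R kern \<delta> (0 + c * x) =
     of_real (c powr (- 1 - \<delta>)) * (indicator {0<..} x *\<^sub>R ((1 - e (real_of_int k * x ^ 2)) / of_real (x powr (1 + \<delta>))))"
    proof (cases "x > 0")
      case True
      have "c powr (- 1 - \<delta>) = 1 / c powr (1 + \<delta>)" using powr_minus[of c "1 + \<delta>"] by (simp add: divide_inverse)
      thus ?thesis using True c(1)
        by (simp add: kern_def powr_mult power_mult_distrib c(2) indicator_def zero_le_mult_iff)
    next
      case False
      \<comment> \<open>At x = 0 the indicators of \<open>{0..}\<close> and \<open>{0<..}\<close>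
        differ, but the kernel takes the default value 0 there.\<close>
      thus ?thesis using c(1) by (cases "x = 0") (auto simp: indicator_def zero_le_mult_iff)
    qed
  qed
  also have "\<bar>c\<bar> *\<^sub>R (LBINT x. of_real (c powr (- 1 - \<delta>)) * (indicator {0<..} x *\<^sub>R ((1 - e (real_of_int k * x ^ 2)) / of_real (x powr (1 + \<delta>)))))
     = of_real (c * c powr (- 1 - \<delta>)) * M_int \<delta> k"
    using c by (subst integral_mult_right_zero) (simp add: M_int_def set_lebesgue_integral_def scaleR_conv_of_real)
  also have "c * c powr (- 1 - \<delta>) = c powr (- \<delta>)"
    using c powr_add[of c 1 "- 1 - \<delta>"] by simp
  finally have "of_real (c powr \<delta>) * kern_integral \<delta> = of_real (c powr \<delta> * c powr (- \<delta>)) * M_int \<delta> k" by simp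
  also have "c powr \<delta> * c powr (- \<delta>) = 1" using c by (simp flip: powr_add)
  finally show ?thesis by (simp add: ck)
qed

text \<open>Kept as a \<open>sums\<close> fact because its conjugate then yields the series for -k,
  convergence included.\<close>

lemma T_sum_sums:
  assumes \<delta>: "0 < \<delta>" "\<delta> \<le> 1" and "k > 0" "p \<ge> 1"
  defines "h \<equiv> sqrt (real_of_int k) / real p"
  shows "(\<lambda>n. e (real_of_int k * real_of_int a0 * real (Suc n) ^ 2 / real q)
            * (1 - e (real_of_int k * real (Suc n) ^ 2 / real p ^ 2))
            / of_real (real (Suc n) powr (1 + \<delta>)))
        sums (of_real (h powr (1 + \<delta>)) * twisted_sum \<delta> k a0 q h)"
proof -
  have h: "h > 0" and h2: "h\<^sup>2 = real_of_int k / real p ^ 2" using assms by (auto simp: h_def power_divide)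
  have "(\<lambda>n. of_real (h powr (1 + \<delta>)) * (coef k a0 q (Suc n) * kern \<delta> (real (Suc n) * h)))
      sums (of_real (h powr (1 + \<delta>)) * twisted_sum \<delta> k a0 q h)"
    unfolding twisted_sum_def by (intro sums_mult summable_sums twisted_summable \<delta> h)
  moreover have "of_real (h powr (1 + \<delta>)) * (coef k a0 q (Suc n) * kern \<delta> (real (Suc n) * h)) =
      e (real_of_int k * real_of_int a0 * real (Suc n) ^ 2 / real q)
            * (1 - e (real_of_int k * real (Suc n) ^ 2 / real p ^ 2))
            / of_real (real (Suc n) powr (1 + \<delta>))" for n
  proof -
    have "(real (Suc n) * h)\<^sup>2 = real_of_int k * real (Suc n) ^ 2 / real p ^ 2"
      by (simp add: power_mult_distrib h2)
    thus ?thesis using h by (simp add: kern_def coef_def powr_mult del: of_nat_Suc)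
  qed
  ultimately show ?thesis by simp
qed

text \<open>Since p h = sqrt k, the scaling factor p^delta h^(1 + delta) equals k^(delta/2) h, and
  k^(delta/2) is also the factor produced by the integral.\<close>

lemma E_err_eq:
  assumes \<delta>: "0 < \<delta>" "\<delta> \<le> 1" and k: "k > 0" and p: "p \<ge> 1"
  defines "h \<equiv> sqrt (real_of_int k) / real p"
  shows "E_err \<delta> a0 q k p = of_real (real_of_int k powr (\<delta> / 2))
     * (of_real h * twisted_sum \<delta> k a0 q h - gauss_mean (k * a0) q * kern_integral \<delta>)"
proof -
  have h: "h > 0" using k p by (simp add: h_def)
  have "real p powr \<delta> * h powr (1 + \<delta>) = (real p * h) powr \<delta> * h"
    using h p by (simp add: powr_mult powr_add)
  also have "(real p * h) powr \<delta> = real_of_int k powr (\<delta> / 2)"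
    using p k by (simp add: h_def sqrt_powr)
  finally have "of_real (real p powr \<delta>) * (of_real (h powr (1 + \<delta>)) * twisted_sum \<delta> k a0 q h)
     = of_real (real_of_int k powr (\<delta> / 2)) * (of_real h * twisted_sum \<delta> k a0 q h)"
    by (metis (no_types) of_real_mult mult.assoc)
  moreover have "T_sum \<delta> a0 q k p = of_real (h powr (1 + \<delta>)) * twisted_sum \<delta> k a0 q h"
    unfolding T_sum_def h_def by (rule sums_unique[symmetric], rule T_sum_sums[OF \<delta> k p])
  ultimately show ?thesis
    unfolding E_err_def M_int_eq[OF k] by (simp add: right_diff_distrib mult_ac)
qed

lemma E_err_uminus:
  assumes \<delta>: "0 < \<delta>" "\<delta> \<le> 1" and k: "k > 0" and p: "p \<ge> 1"
  shows "E_err \<delta> a0 q (- k) p = cnj (E_err \<delta> a0 q k p)"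
proof -
  note sums = T_sum_sums[OF \<delta> k p, of a0 q]
  have "T_sum \<delta> a0 q (- k) p = cnj (T_sum \<delta> a0 q k p)"
    unfolding T_sum_def sums_unique[OF sums, symmetric]
    using sums[THEN sums_cnj[THEN iffD2]]
    by (intro sums_unique[symmetric]) (simp add: e_minus)
  moreover have "gauss_mean (- k * a0) q = cnj (gauss_mean (k * a0) q)"
    by (simp add: gauss_mean_def e_minus)
  moreover have "M_int \<delta> (- k) = cnj (M_int \<delta> k)"
    unfolding M_int_def set_lebesgue_integral_def Bochner_Integration.integral_cnj[symmetric]
    by (rule Bochner_Integration.integral_cong) (simp_all add: e_minus)
  ultimately show ?thesis by (simp add: E_err_def)
qed

lemma norm_E_err_le:
  assumes \<delta>: "0 < \<delta>" "\<delta> \<le> 1" and k: "k > 0" and p: "p \<ge> 1" and q: "q \<ge> 1" and \<alpha>: "0 < \<alpha>" "\<alpha> \<le> 1"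
  shows "norm (E_err \<delta> a0 q k p)
     \<le> (32 * pi + 684 * zsum \<delta> + 1204 + 32 * pi / \<delta>) * real q * real_of_int k powr ((\<alpha> + \<delta>) / 2) * real p powr (- \<alpha>)"
proof -
  define h where "h = sqrt (real_of_int k) / real p"
  let ?C = "32 * pi + 684 * zsum \<delta> + 1204 + 32 * pi / \<delta>"
  have h: "h > 0" using k p by (simp add: h_def)
  have ha: "h powr \<alpha> = real_of_int k powr (\<alpha> / 2) * real p powr (- \<alpha>)"
    using k p by (simp add: h_def powr_divide sqrt_powr powr_minus_divide)
  have "norm (E_err \<delta> a0 q k p) = real_of_int k powr (\<delta> / 2)
      * norm (of_real h * twisted_sum \<delta> k a0 q h - gauss_mean (k * a0) q * kern_integral \<delta>)"
    unfolding E_err_eq[OF \<delta> k p] h_def by (simp add: norm_mult)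
  also have "\<dots> \<le> real_of_int k powr (\<delta> / 2) * (?C * (real q * h powr \<alpha>))"
    by (intro mult_left_mono twisted_sum_error \<delta> h q \<alpha>) auto
  also have "\<dots> = ?C * real q * (real_of_int k powr (\<alpha> / 2) * real_of_int k powr (\<delta> / 2)) * real p powr (- \<alpha>)"
    unfolding ha by (simp only: mult_ac)
  also have "real_of_int k powr (\<alpha> / 2) * real_of_int k powr (\<delta> / 2) = real_of_int k powr ((\<alpha> + \<delta>) / 2)"
    by (simp add: add_divide_distrib flip: powr_add)
  finally show ?thesis .
qed

theorem lemma3p2:
  fixes \<delta> :: real
  assumes "0 < \<delta>" and "\<delta> \<le> 1"
  shows "\<exists>C::real. C > 0 \<and>
    (\<forall>(p::nat) (k::int) (q0::nat) (a0::int) (\<alpha>::real).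
       prime p \<longrightarrow> k \<noteq> 0 \<longrightarrow> q0 \<ge> 1 \<longrightarrow> coprime a0 (int q0) \<longrightarrow>
       0 < \<alpha> \<longrightarrow> \<alpha> \<le> 1 \<longrightarrow>
       norm (E_err \<delta> a0 q0 k p)
         \<le> C * real q0 * \<bar>real_of_int k\<bar> powr ((\<alpha> + \<delta>) / 2) * real p powr (- \<alpha>))"
proof (intro exI conjI allI impI)
  show "32 * pi + 684 * zsum \<delta> + 1204 + 32 * pi / \<delta> > 0"
    using assms zsum_nonneg[of \<delta>] by (intro add_nonneg_pos add_pos_nonneg) auto
  fix p q0 :: nat and k a0 :: int and \<alpha> :: real
  assume "prime p" "k \<noteq> 0" and q0: "q0 \<ge> 1" and \<alpha>: "0 < \<alpha>" "\<alpha> \<le> 1"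
  have p: "p \<ge> 1" using prime_ge_1_nat[OF \<open>prime p\<close>] .
  have "norm (E_err \<delta> a0 q0 k p) = norm (E_err \<delta> a0 q0 \<bar>k\<bar> p)"
  proof (cases "k > 0")
    case False
    thus ?thesis using E_err_uminus[OF assms, of "- k" p a0 q0] \<open>k \<noteq> 0\<close> p by simp
  qed simp
  also have "\<dots> \<le> (32 * pi + 684 * zsum \<delta> + 1204 + 32 * pi / \<delta>) * real q0
      * real_of_int \<bar>k\<bar> powr ((\<alpha> + \<delta>) / 2) * real p powr (- \<alpha>)"
    using \<open>k \<noteq> 0\<close> by (intro norm_E_err_le assms p q0 \<alpha>) auto
  finally show "norm (E_err \<delta> a0 q0 k p) \<le> (32 * pi + 684 * zsum \<delta> + 1204 + 32 * pi / \<delta>) * real q0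
      * \<bar>real_of_int k\<bar> powr ((\<alpha> + \<delta>) / 2) * real p powr (- \<alpha>)"
    by simp
qed

end
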